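(* Consider the system $x(t+1)=Ax(t)+Bu(t)$, $y(t)=Cx(t)$ with $x(t)\in\mathbb{R}^n$, $u(t)\in\mathbb{R}^m$, $y(t)\in\mathbb{R}^l$, assumed controllable and observable, with weight matrices $Q\succeq 0$, $R\succ 0$ and control horizon $T$. Let $K_{\mathrm{LQR}}^{t}$ be the controller gain for which the optimal LQR input is $u(t)=K_{\mathrm{LQR}}^{t}\begin{bmatrix}U_n(t)\\ Y_n(t)\end{bmatrix}$, namely $$K_{\mathrm{LQR}}^{t}=-K_t\begin{bmatrix}F_u-A^n\mathcal{O}^{\dagger}\bm{S}_{T-n+1} & A^n\mathcal{O}^{\dagger}\end{bmatrix}.$$ Then $K_{\mathrm{LQR}}^{t}$ has the following alternative expression: $$K_{\mathrm{LQR}}^{t}=-\Big[R+\bm{M}_{t+1}^{\mathsf T}\big(\bm{Q}_{t+1}^{-1}+\bm{S}_{t+1}\bm{R}_{t+1}^{-1}\bm{S}_{t+1}^{\mathsf T}\big)\bm{M}_{t+1}\Big]^{-1}\bm{M}_{t+1}^{\mathsf T}\big(\bm{Q}_{t+1}^{-1}+\bm{S}_{t+1}\bm{R}_{t+1}^{-1}\bm{S}_{t+1}^{\mathsf T}\big)\begin{bmatrix}E-F\bm{S}_{T-n+1} & F\end{bmatrix},$$ where $\bm{Q}_s$, $\bm{R}_s$ are block diagonal matrices built from $Q$ and $R$, and $\bm{M}_s$, $\bm{S}_s$, $E$, $F$ are constructed from the impulse responses $M(1:T)=\{M(1),\dots,M(T)\}$ collected from the (unknown) system, all as defined in the context.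
   Context: The finite-horizon LQR problem minimizes $y(T)^{\mathsf T}Qy(T)+\sum_{t=0}^{T-1}\big(y(t)^{\mathsf T}Qy(t)+u(t)^{\mathsf T}Ru(t)\big)$. Its optimal input is $u(t)=-K_tx(t)$ with $K_t=(R+B^{\mathsf T}P_{t+1}B)^{-1}B^{\mathsf T}P_{t+1}A$, where $P_T=C^{\mathsf T}QC$ and, backwards in time, $P_t=A^{\mathsf T}P_{t+1}A-A^{\mathsf T}P_{t+1}B(R+B^{\mathsf T}P_{t+1}B)^{-1}B^{\mathsf T}P_{t+1}A+C^{\mathsf T}QC$. $U_n(t)$ stacks the past inputs $u(t-n),\dots,u(t-1)$ and $Y_n(t)$ stacks the past outputs $y(t-n),\dots,y(t-1)$. $F_u=\begin{bmatrix}A^{n-1}B&\cdots&AB&B\end{bmatrix}$, $\mathcal{O}=\begin{bmatrix}C^{\mathsf T}&(CA)^{\mathsf T}&\cdots&(CA^{n-1})^{\mathsf T}\end{bmatrix}^{\mathsf T}$. $X^{\dagger}$ is the pseudoinverse, $\otimes$ the Kronecker product. The impulse response is $M(s)=CA^{s-1}B\in\mathbb{R}^{l\times m}$. For an index $s$: $\bm{Q}_s=\mathrm{diag}(Q,\dots,Q)$ and $\bm{R}_s=\mathrm{diag}(R,\dots,R)$, each with $T-s+1$ diagonal blocks; $\bm{S}_s$ is the strictly block lower triangular block Toeplitz matrix with $T-s+1$ block rows and columns whose $(i,j)$ block is $M(i-j)$ for $i>j$ and $0$ for $i\le j$ (last block row $[M(T-s)\ M(T-s-1)\ \cdots\ M(1)\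 0]$); $\bm{M}_s$ is the block column with blocks $M(1),\dots,M(T-s+1)$. $E$ is the block matrix with $T-t$ block rows and $n$ block columns whose first block row is $[M(n+1)\ \cdots\ M(2)]$ and whose last block row is $[M(T-t+n)\ \cdots\ M(T-t+1)]$, i.e. the $(i,j)$ block is $M(n+1+i-j)$. Coefficients $\bm{\alpha}$: let $\bm{\alpha}=[\alpha_1\ \cdots\ \alpha_n]$ be the coefficients of the characteristic polynomial of $A$, so $A^n+\alpha_1I+\alpha_2A+\cdots+\alpha_nA^{n-1}=0$. With $M^j(s)$ the $j$-th column of $M(s)$, $j\in\{1,\dots,m\}$, $\bm{\alpha}$ is obtained from data by $$\bm{\alpha}^{\mathsf T}=-\begin{bmatrix}M^j(1)&\cdots&M^j(n)\\ \vdots&\ddots&\vdots\\ M^j(n)&\cdots&M^j(2n-1)\end{bmatrix}^{\dagger}\begin{bmatrix}M^j(n+1)\\ \vdots\\ M^j(2n)\end{bmatrix}.$$ Matrix $F$ when $l=1$: for $-n\le i<0$, $F_i$ is the $(n+i+1)$-th row of $I_n$; for $i\ge 0$, recursively $F_i=-\bm{\alpha}\begin{bmatrix}F_{i-n}^{\mathsf T}&\cdots&F_{i-1}^{\mathsf T}\end{bmatrix}^{\mathsf T}$; then $F=\begin{bmatrix}F_1^{\mathsf T}&\cdots&F_{T-t}^{\mathsf T}\end{bmatrix}^{\mathsf T}$. Matrix $F$ when $l>1$: take the QR factorization $LH$ of the data matrix whose $(i,j)$ block is $M(i+j-1)$, $1\le i\le n$, $1\le j\le k$, where $L\in\mathbb{R}^{nl\times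 nl}$ is orthogonal, $H\in\mathbb{R}^{nl\times mk}$, and $k$ satisfies $mk\ge n$. Let $\tilde{\mathcal{O}}$ be the first $n$ columns of $L$, and $\tilde L=\tilde{\mathcal{O}}\tilde{\mathcal{O}}^{\dagger}=\begin{bmatrix}\tilde L_1^{\mathsf T}&\cdots&\tilde L_n^{\mathsf T}\end{bmatrix}^{\mathsf T}$ with block rows $\tilde L_j\in\mathbb{R}^{l\times nl}$. For $-n\le i<0$ put $F_i=\tilde L_{n+i+1}$; for $i\ge0$, recursively $F_i=-(\bm{\alpha}\otimes I_l)\begin{bmatrix}F_{i-n}^{\mathsf T}&\cdots&F_{i-1}^{\mathsf T}\end{bmatrix}^{\mathsf T}$; $F$ is assembled from $F_1,\dots,F_{T-t}$ as for $l=1$.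
   Formalization: The weight is corrected to (Q_{t+1}^{-1}+S_{t+1}R_{t+1}^{-1}S_{t+1}^T)^{-1}; Q is assumed invertible; for l>1 the data matrix has rank n and rows of H beyond n vanish; α is the characteristic coefficients, or the data formula if column j's Hankel matrix has rank n. *)

theory Defs
  imports
    "Jordan_Normal_Form.Char_Poly"
    "Jordan_Normal_Form.DL_Rank"
    "Jordan_Normal_Form.Gauss_Jordan_Elimination"
begin

section \<open>Matrix notions\<close>

text \<open>Only meaningful for invertible matrices: \<open>mat_inverse\<close> returns \<open>None\<close> otherwise.\<close>

definition minv :: "real mat \<Rightarrow> real mat" where
  "minv X = the (mat_inverse X)"

definition psd_mat :: "nat \<Rightarrow> real mat \<Rightarrow> bool" where
  "psd_mat d X \<longleftrightarrow> X \<in> carrier_mat d d \<and> transpose_mat X = X \<and>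
     (\<forall>v \<in> carrier_vec d. 0 \<le> v \<bullet> (X *\<^sub>v v))"

definition pd_mat :: "nat \<Rightarrow> real mat \<Rightarrow> bool" where
  "pd_mat d X \<longleftrightarrow> X \<in> carrier_mat d d \<and> transpose_mat X = X \<and>
     (\<forall>v \<in> carrier_vec d. v \<noteq> 0\<^sub>v d \<longrightarrow> 0 < v \<bullet> (X *\<^sub>v v))"

text \<open>The Moore-Penrose pseudoinverse, by the four Penrose conditions.\<close>

definition is_pinv :: "real mat \<Rightarrow> real mat \<Rightarrow> bool" where
  "is_pinv X Y \<longleftrightarrow> Y \<in> carrier_mat (dim_col X) (dim_row X) \<and>
     X * Y * X = X \<and> Y * X * Y = Y \<and>
     transpose_mat (X * Y) = X * Y \<and> transpose_mat (Y * X) = Y * X"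

definition pinv :: "real mat \<Rightarrow> real mat" where
  "pinv X = (THE Y. is_pinv X Y)"

definition kron :: "real mat \<Rightarrow> real mat \<Rightarrow> real mat" where
  "kron X Y = mat (dim_row X * dim_row Y) (dim_col X * dim_col Y)
     (\<lambda>(i, j). X $$ (i div dim_row Y, j div dim_col Y) * Y $$ (i mod dim_row Y, j mod dim_col Y))"

definition append_cols :: "real mat \<Rightarrow> real mat \<Rightarrow> real mat" where
  "append_cols X Y = four_block_mat X Y (0\<^sub>m 0 (dim_col X)) (0\<^sub>m 0 (dim_col Y))"

text \<open>Matrix with \<open>N\<close> block rows and \<open>K\<close> block columns of \<open>r \<times> c\<close> blocks; the block function
  is indexed from 1.\<close>

definition block_mat :: "nat \<Rightarrow> nat \<Rightarrow> nat \<Rightarrow> nat \<Rightarrow> (nat \<Rightarrow> nat \<Rightarrow> real mat) \<Rightarrow> real mat" where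
  "block_mat N K r c f = mat (N * r) (K * c)
     (\<lambda>(i, j). f (i div r + 1) (j div c + 1) $$ (i mod r, j mod c))"

text \<open>Vertical stack of a list of \<open>r \<times> c\<close> blocks.\<close>

definition stack :: "nat \<Rightarrow> nat \<Rightarrow> real mat list \<Rightarrow> real mat" where
  "stack r c Xs = block_mat (length Xs) 1 r c (\<lambda>i _. Xs ! (i - 1))"

text \<open>The rows \<open>k * r, \<dots>, k * r + r - 1\<close> (counted from 0).\<close>

definition block_row :: "nat \<Rightarrow> real mat \<Rightarrow> nat \<Rightarrow> real mat" where
  "block_row r X k = mat r (dim_col X) (\<lambda>(i, j). X $$ (k * r + i, j))"

text \<open>QR factorization of a matrix that need not have full rank. The triangular factor is in
  trapezoidal form, so that the first \<open>rank D\<close> columns of \<open>L\<close> span the column space of \<open>D\<close>; if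
  the first \<open>rank D\<close> columns of \<open>D\<close> are linearly independent, this last condition holds for
  every QR factorization. \<open>orthogonal_mat\<close> does not require columns of norm 1, and
  \<open>upper_triangular\<close> reads entries outside a matrix with more rows than columns.\<close>

definition is_QR :: "real mat \<Rightarrow> real mat \<Rightarrow> real mat \<Rightarrow> bool" where
  "is_QR D L H \<longleftrightarrow>
     L \<in> carrier_mat (dim_row D) (dim_row D) \<and> H \<in> carrier_mat (dim_row D) (dim_col D) \<and>
     D = L * H \<and> transpose_mat L * L = 1\<^sub>m (dim_row D) \<and>
     (\<forall>i < dim_row D. \<forall>j < dim_col D. j < i \<longrightarrow> H $$ (i, j) = 0) \<and>
     (\<forall>i < dim_row D. \<forall>j < dim_col D. vec_space.rank (dim_row D) D \<le> i \<longrightarrow> H $$ (i, j) = 0)"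

section \<open>The system and its LQR gain\<close>

text \<open>Throughout, \<open>A\<close> is \<open>n \<times> n\<close>, \<open>B\<close> is \<open>n \<times> m\<close>, \<open>C\<close> is \<open>l \<times> n\<close>, with \<open>n\<close>, \<open>m\<close>, \<open>l\<close> read off
  the matrices.\<close>

definition ctrb_mat :: "real mat \<Rightarrow> real mat \<Rightarrow> real mat" where
  "ctrb_mat A B = block_mat 1 (dim_row A) (dim_row A) (dim_col B)
     (\<lambda>_ j. A ^\<^sub>m (dim_row A - j) * B)"

definition obsv_mat :: "real mat \<Rightarrow> real mat \<Rightarrow> real mat" where
  "obsv_mat A C = block_mat (dim_row A) 1 (dim_row C) (dim_row A) (\<lambda>i _. C * A ^\<^sub>m (i - 1))"

definition controllable :: "real mat \<Rightarrow> real mat \<Rightarrow> bool" where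
  "controllable A B \<longleftrightarrow> vec_space.rank (dim_row A) (ctrb_mat A B) = dim_row A"

definition observable :: "real mat \<Rightarrow> real mat \<Rightarrow> bool" where
  "observable A C \<longleftrightarrow> vec_space.rank (dim_row A * dim_row C) (obsv_mat A C) = dim_row A"

text \<open>\<open>riccati A B C Q R k\<close> is the Riccati matrix with \<open>k\<close> steps to go.\<close>

primrec riccati :: "real mat \<Rightarrow> real mat \<Rightarrow> real mat \<Rightarrow> real mat \<Rightarrow> real mat \<Rightarrow> nat \<Rightarrow> real mat" where
  "riccati A B C Q R 0 = transpose_mat C * Q * C"
| "riccati A B C Q R (Suc k) = (let P = riccati A B C Q R k in
     transpose_mat A * P * A
     - transpose_mat A * P * B * minv (R + transpose_mat B * P * B) * transpose_mat B * P * A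
     + transpose_mat C * Q * C)"

definition riccati_P ::
    "real mat \<Rightarrow> real mat \<Rightarrow> real mat \<Rightarrow> real mat \<Rightarrow> real mat \<Rightarrow> nat \<Rightarrow> nat \<Rightarrow> real mat" where
  "riccati_P A B C Q R T t = riccati A B C Q R (T - t)"

definition state_gain ::
    "real mat \<Rightarrow> real mat \<Rightarrow> real mat \<Rightarrow> real mat \<Rightarrow> real mat \<Rightarrow> nat \<Rightarrow> nat \<Rightarrow> real mat" where
  "state_gain A B C Q R T t = (let P = riccati_P A B C Q R T (t + 1) in
     minv (R + transpose_mat B * P * B) * transpose_mat B * P * A)"

section \<open>Impulse response matrices\<close>

definition impulse :: "real mat \<Rightarrow> real mat \<Rightarrow> real mat \<Rightarrow> nat \<Rightarrow> real mat" where
  "impulse A B C s = C * A ^\<^sub>m (s - 1) * B"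

text \<open>The lower index \<open>s\<close> is an integer, since \<open>s = T - n + 1\<close> is not positive for \<open>n > T\<close>.\<close>

definition num_blocks :: "nat \<Rightarrow> int \<Rightarrow> nat" where
  "num_blocks T s = nat (int T - s + 1)"

definition big_diag :: "real mat \<Rightarrow> nat \<Rightarrow> int \<Rightarrow> real mat" where
  "big_diag X T s = diag_block_mat (replicate (num_blocks T s) X)"

definition big_S :: "real mat \<Rightarrow> real mat \<Rightarrow> real mat \<Rightarrow> nat \<Rightarrow> int \<Rightarrow> real mat" where
  "big_S A B C T s = block_mat (num_blocks T s) (num_blocks T s) (dim_row C) (dim_col B)
     (\<lambda>i j. if j < i then impulse A B C (i - j) else 0\<^sub>m (dim_row C) (dim_col B))"

definition big_M :: "real mat \<Rightarrow> real mat \<Rightarrow> real mat \<Rightarrow> nat \<Rightarrow> int \<Rightarrow> real mat" where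
  "big_M A B C T s = block_mat (num_blocks T s) 1 (dim_row C) (dim_col B)
     (\<lambda>i _. impulse A B C i)"

definition mat_E :: "real mat \<Rightarrow> real mat \<Rightarrow> real mat \<Rightarrow> nat \<Rightarrow> nat \<Rightarrow> real mat" where
  "mat_E A B C T t = block_mat (T - t) (dim_row A) (dim_row C) (dim_col B)
     (\<lambda>i j. impulse A B C (dim_row A + 1 + i - j))"

text \<open>\<open>(Q\<^sub>s\<^sup>-\<^sup>1 + S\<^sub>s R\<^sub>s\<^sup>-\<^sup>1 S\<^sub>s\<^sup>T)\<^sup>-\<^sup>1\<close>: the weight on \<open>z\<close> in the minimum over \<open>v\<close> of
  \<open>(z + S\<^sub>s v)\<^sup>T Q\<^sub>s (z + S\<^sub>s v) + v\<^sup>T R\<^sub>s v\<close>. The outer inverse is essential: with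
  \<open>A = B = C = R = 1\<close>, \<open>Q = 2\<close>, \<open>T = 1\<close>, \<open>t = 0\<close> the LQR gain is \<open>-2/3\<close> in both
  entries, whereas dropping the outer inverse would give \<open>-1/3\<close>.\<close>

definition big_W ::
    "real mat \<Rightarrow> real mat \<Rightarrow> real mat \<Rightarrow> real mat \<Rightarrow> real mat \<Rightarrow> nat \<Rightarrow> int \<Rightarrow> real mat" where
  "big_W A B C Q R T s =
     minv (minv (big_diag Q T s)
           + big_S A B C T s * minv (big_diag R T s) * transpose_mat (big_S A B C T s))"

section \<open>The coefficients and the matrix F\<close>

text \<open>Both descriptions of the coefficients are \<open>1 \<times> n\<close> matrices. The second one uses column
  \<open>j\<close> (counted from 0) of the impulse response.\<close>

definition char_coeffs :: "real mat \<Rightarrow> real mat" where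
  "char_coeffs A = mat 1 (dim_row A) (\<lambda>(_, i). coeff (char_poly A) i)"

definition impulse_col :: "real mat \<Rightarrow> real mat \<Rightarrow> real mat \<Rightarrow> nat \<Rightarrow> nat \<Rightarrow> real mat" where
  "impulse_col A B C j s = mat_of_cols (dim_row C) [col (impulse A B C s) j]"

definition col_hankel :: "real mat \<Rightarrow> real mat \<Rightarrow> real mat \<Rightarrow> nat \<Rightarrow> real mat" where
  "col_hankel A B C j = block_mat (dim_row A) (dim_row A) (dim_row C) 1
     (\<lambda>p q. impulse_col A B C j (p + q - 1))"

definition data_coeffs :: "real mat \<Rightarrow> real mat \<Rightarrow> real mat \<Rightarrow> nat \<Rightarrow> real mat" where
  "data_coeffs A B C j = transpose_mat
     (- (pinv (col_hankel A B C j) *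
         block_mat (dim_row A) 1 (dim_row C) 1 (\<lambda>p _. impulse_col A B C j (dim_row A + p))))"

text \<open>The characteristic polynomial coefficients, or their computation from the data. The
  latter needs a column \<open>j\<close> whose data determine the coefficients, that is, whose Hankel matrix
  has full column rank \<open>n\<close>: for a zero column of \<open>B\<close>, for instance, it would return 0.\<close>

definition is_coeffs :: "real mat \<Rightarrow> real mat \<Rightarrow> real mat \<Rightarrow> real mat \<Rightarrow> bool" where
  "is_coeffs A B C \<alpha> \<longleftrightarrow> \<alpha> = char_coeffs A \<or>
     (\<exists>j < dim_col B.
        vec_space.rank (dim_row A * dim_row C) (col_hankel A B C j) = dim_row A \<and>
        \<alpha> = data_coeffs A B C j)"

definition data_hankel :: "real mat \<Rightarrow> real mat \<Rightarrow> real mat \<Rightarrow> nat \<Rightarrow> real mat" where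
  "data_hankel A B C k = block_mat (dim_row A) k (dim_row C) (dim_col B)
     (\<lambda>i j. impulse A B C (i + j - 1))"

text \<open>\<open>F_seq n l c X (n + i)\<close> is \<open>F\<^sub>i\<close> for \<open>i \<ge> -n\<close>: the first \<open>n\<close> members are the block rows
  of \<open>X\<close>, the others follow by recursion with coefficient row \<open>c\<close>.\<close>

function F_seq :: "nat \<Rightarrow> nat \<Rightarrow> real mat \<Rightarrow> real mat \<Rightarrow> nat \<Rightarrow> real mat" where
  "F_seq n l c X k =
     (if k < n then block_row l X k
      else - (c * stack l (dim_col X) (map (F_seq n l c X) [k - n ..< k])))"
  by pat_completeness auto
termination
  by (relation "measure (\<lambda>(n, l, c, X, k). k)") auto

declare F_seq.simps [simp del]

text \<open>\<open>L\<close> is the orthogonal factor of \<open>data_hankel\<close>; it is not used for \<open>l = 1\<close>.\<close>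

definition mat_F :: "nat \<Rightarrow> nat \<Rightarrow> real mat \<Rightarrow> real mat \<Rightarrow> nat \<Rightarrow> nat \<Rightarrow> real mat" where
  "mat_F n l \<alpha> L T t =
     (let G = (if l = 1 then F_seq n 1 \<alpha> (1\<^sub>m n)
               else let O\<^sub>L = mat_of_cols (n * l) (take n (cols L))
                    in F_seq n l (kron \<alpha> (1\<^sub>m l)) (O\<^sub>L * pinv O\<^sub>L))
      in stack l (n * l) (map (\<lambda>i. G (n + i)) [1 ..< T - t + 1]))"

definition K_LQR ::
    "real mat \<Rightarrow> real mat \<Rightarrow> real mat \<Rightarrow> real mat \<Rightarrow> real mat \<Rightarrow> nat \<Rightarrow> nat \<Rightarrow> real mat" where
  "K_LQR A B C Q R T t =
     (let n = dim_row A; An_O = A ^\<^sub>m n * pinv (obsv_mat A C) in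
      - (state_gain A B C Q R T t *
         append_cols (ctrb_mat A B - An_O * big_S A B C T (int T - int n + 1)) An_O))"

end

(*
  Completing the square block by block inverts Q_s^-1 + S_s R_s^-1 S_s^T: by Woodbury's identity the
  inverse for one more step is diag(Q, W - W M (R + M^T W M)^-1 M^T W), which is the Riccati
  recursion, so P_{t+1} = O^T W_{t+1} O with O the extended observability matrix. Since
  M_{t+1} = O B, it remains to see that O A maps [F_u - A^n Y S, A^n Y] to [E - F S, F], where Y is
  the pseudoinverse of the observability matrix. For E this is a product of Markov parameters. For F
  it says F_i = C A^(n+i) Y: the start values are block rows of the orthogonal projection onto the
  range of the observability matrix (which the data matrix spans, its rank being n), and the
  recursion is the Cayley-Hamilton theorem.
*)

theory Submission
  imports Defs
begin

text \<open>Values of \<open>minv\<close> and \<open>pinv\<close> are usable only after existence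
  has been shown, so the obstacle is to secure every inverse along the recursion. R + M^T W M is
  positive definite once W is semidefinite, but the recursion subtracts a term and hides this. The
  inverse of W, in contrast, is visibly semidefinite: a block diagonal matrix plus a congruence.
  Inversion and semidefiniteness therefore support each other inside one induction. The horizon
  grows at its front. An additional first output multiplies the older observability blocks by A, and
  an additional first input acts only through \<open>markov_col\<close>; this is what makes the
  inverse weight split into two diagonal blocks. Rank hypotheses are turned into trivial kernels,
  which pass easily to the factors of a product. In this way the QR factor and the observability
  matrix are seen to have the same range, although neither is computed from the other.\<close>

text \<open>With \<open>carrier_mat\<close> premises the inner dimension is a variable not determined by the redex,
  so the simplifier cannot discharge them; with equations between dimensions it can.\<close>

lemma mult_assoc_dim:
  fixes X Y Z :: "'a :: semiring_0 mat"
  shows "dim_col X = dim_row Y \<Longrightarrow> dim_col Y = dim_row Z \<Longrightarrow> X * Y * Z = X * (Y * Z)"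
  by (rule assoc_mult_mat) auto

lemma mult_mat_vec_dim:
  fixes X Y :: "'a :: semiring_0 mat"
  shows "dim_col X = dim_row Y \<Longrightarrow> dim_col Y = dim_vec v \<Longrightarrow> (X * Y) *\<^sub>v v = X *\<^sub>v (Y *\<^sub>v v)"
  by (rule assoc_mult_mat_vec) auto

lemma transpose_mult_dim:
  fixes X Y :: "'a :: comm_semiring_0 mat"
  shows "dim_col X = dim_row Y \<Longrightarrow> transpose_mat (X * Y) = transpose_mat Y * transpose_mat X"
  by (rule transpose_mult) auto

lemma mult_minus_distrib_dim:
  fixes X Y Z :: "'a :: ring mat"
  shows "dim_col X = dim_row Y \<Longrightarrow> dim_row Z = dim_row Y \<Longrightarrow> dim_col Z = dim_col Y \<Longrightarrow>
    X * (Y - Z) = X * Y - X * Z"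
  by (rule mult_minus_distrib_mat) auto

lemma minus_mult_distrib_dim:
  fixes X Y Z :: "'a :: ring mat"
  shows "dim_col X = dim_row Z \<Longrightarrow> dim_row X = dim_row Y \<Longrightarrow> dim_col X = dim_col Y \<Longrightarrow>
    (X - Y) * Z = X * Z - Y * Z"
  by (rule minus_mult_distrib_mat) auto

lemma mult_add_distrib_dim:
  fixes X Y Z :: "'a :: semiring_0 mat"
  shows "dim_col X = dim_row Y \<Longrightarrow> dim_row Z = dim_row Y \<Longrightarrow> dim_col Z = dim_col Y \<Longrightarrow>
    X * (Y + Z) = X * Y + X * Z"
  by (rule mult_add_distrib_mat) auto

lemma add_mult_distrib_dim:
  fixes X Y Z :: "'a :: semiring_0 mat"
  shows "dim_col X = dim_row Z \<Longrightarrow> dim_row X = dim_row Y \<Longrightarrow> dim_col X = dim_col Y \<Longrightarrow>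
    (X + Y) * Z = X * Z + Y * Z"
  by (rule add_mult_distrib_mat) auto

lemma one_mult_dim:
  fixes X :: "'a :: semiring_1 mat"
  shows "dim_row X = k \<Longrightarrow> 1\<^sub>m k * X = X" "dim_col X = k \<Longrightarrow> X * 1\<^sub>m k = X"
  by auto

lemmas distrib_dim = mult_minus_distrib_dim minus_mult_distrib_dim mult_add_distrib_dim
  add_mult_distrib_dim

text \<open>A one-sided inverse suffices because the matrices are square; \<open>mat_inverse\<close>
  succeeds on units, and uniqueness of inverses identifies its value. Every evaluation of
  \<open>minv\<close> goes through this fact.\<close>

lemma minv_eq:
  assumes X: "X \<in> carrier_mat k k" and Y: "Y \<in> carrier_mat k k" and XY: "X * Y = 1\<^sub>m k"
  shows "minv X = Y"
proof -
  have YX: "Y * X = 1\<^sub>m k"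
    by (rule mat_mult_left_right_inverse[OF X Y XY])
  have "X \<in> Units (ring_mat TYPE(real) k ())"
    using X Y XY YX unfolding Units_def by (auto simp: ring_mat_simps)
  then obtain Z where Z: "mat_inverse X = Some Z"
    using mat_inverse(1)[OF X, of "()"] by (cases "mat_inverse X") auto
  have ZX: "Z * X = 1\<^sub>m k" and Zc: "Z \<in> carrier_mat k k"
    using mat_inverse(2)[OF X Z] by auto
  have "Z = Z * (X * Y)" using Zc XY by simp
  also have "\<dots> = Z * X * Y" using Zc X Y by simp
  also have "\<dots> = Y" using ZX Y by simp
  finally show ?thesis using Z by (simp add: minv_def)
qed

section \<open>Semidefinite and definite matrices\<close>

lemma psd_matD:
  assumes "psd_mat d X"
  shows "X \<in> carrier_mat d d" "transpose_mat X = X" "v \<in> carrier_vec d \<Longrightarrow> 0 \<le> v \<bullet> (X *\<^sub>v v)"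
  using assms by (auto simp: psd_mat_def)

lemma pd_matD:
  assumes "pd_mat d X"
  shows "X \<in> carrier_mat d d" "transpose_mat X = X"
    "v \<in> carrier_vec d \<Longrightarrow> v \<noteq> 0\<^sub>v d \<Longrightarrow> 0 < v \<bullet> (X *\<^sub>v v)"
  using assms by (auto simp: pd_mat_def)

lemma pd_imp_psd:
  assumes "pd_mat d X"
  shows "psd_mat d X"
  unfolding psd_mat_def
proof (intro conjI ballI)
  fix v :: "real vec" assume v: "v \<in> carrier_vec d"
  show "0 \<le> v \<bullet> (X *\<^sub>v v)"
  proof (cases "v = 0\<^sub>v d")
    case True
    have "X *\<^sub>v v \<in> carrier_vec d" using pd_matD(1)[OF assms] v by auto
    then show ?thesis using True by simp
  next
    case False
    then show ?thesis using pd_matD(3)[OF assms v] by simp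
  qed
qed (use assms in \<open>auto simp: pd_mat_def\<close>)

lemma quadratic_form_congruence:
  fixes W M :: "real mat"
  assumes "W \<in> carrier_mat r r" "M \<in> carrier_mat r c" "v \<in> carrier_vec c"
  shows "v \<bullet> ((transpose_mat M * W * M) *\<^sub>v v) = (M *\<^sub>v v) \<bullet> (W *\<^sub>v (M *\<^sub>v v))"
proof -
  define w where "w = W *\<^sub>v (M *\<^sub>v v)"
  have w: "w \<in> carrier_vec r" using assms by (auto simp: w_def)
  have "(transpose_mat M * W * M) *\<^sub>v v = transpose_mat M *\<^sub>v w"
    using assms by (simp add: w_def mult_mat_vec_dim)
  then have "v \<bullet> ((transpose_mat M * W * M) *\<^sub>v v) = (transpose_mat M *\<^sub>v w) \<bullet> v"
    using assms w by (simp add: comm_scalar_prod[of _ c])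
  also have "\<dots> = w \<bullet> (M *\<^sub>v v)"
    by (rule transpose_vec_mult_scalar) (use assms w in auto)
  also have "\<dots> = (M *\<^sub>v v) \<bullet> w"
    using assms w by (intro comm_scalar_prod[of _ r]) auto
  finally show ?thesis by (simp add: w_def)
qed

lemma psd_congruence:
  assumes W: "psd_mat r W" and M: "M \<in> carrier_mat r c"
  shows "psd_mat c (transpose_mat M * W * M)"
  unfolding psd_mat_def
proof (intro conjI ballI)
  note Wc = psd_matD(1)[OF W]
  fix v :: "real vec" assume v: "v \<in> carrier_vec c"
  have "M *\<^sub>v v \<in> carrier_vec r" using M v by auto
  then show "0 \<le> v \<bullet> ((transpose_mat M * W * M) *\<^sub>v v)"
    using psd_matD(3)[OF W] by (simp add: quadratic_form_congruence[OF Wc M v])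
qed (use psd_matD[OF W] M in \<open>auto simp: transpose_mult_dim mult_assoc_dim\<close>)

lemma psd_add:
  assumes "psd_mat d X" "psd_mat d Y"
  shows "psd_mat d (X + Y)"
  using psd_matD[OF assms(1)] psd_matD[OF assms(2)]
  by (auto simp: psd_mat_def transpose_add[of _ d d] add_mult_distrib_mat_vec[of _ d d]
      scalar_prod_add_distrib[of _ d])

lemma pd_add_psd:
  assumes X: "pd_mat d X" and Y: "psd_mat d Y"
  shows "pd_mat d (X + Y)"
  using pd_matD[OF X] psd_matD[OF Y]
  by (auto simp: pd_mat_def transpose_add[of _ d d] add_mult_distrib_mat_vec[of _ d d]
      scalar_prod_add_distrib[of _ d] add_pos_nonneg)

text \<open>A kernel vector would make the quadratic form vanish, so the determinant is
  nonzero.\<close>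

lemma pd_inverse_exists:
  assumes X: "pd_mat d X"
  obtains Y where "Y \<in> carrier_mat d d" "X * Y = 1\<^sub>m d" "Y * X = 1\<^sub>m d" "minv X = Y"
proof -
  note Xc = pd_matD(1)[OF X]
  have "det X \<noteq> 0"
    unfolding det_0_iff_vec_prod_zero[OF Xc] using pd_matD(3)[OF X] by fastforce
  from det_non_zero_imp_unit[OF Xc this, of "()"] obtain Y where
    Y: "Y \<in> carrier_mat d d" "X * Y = 1\<^sub>m d" "Y * X = 1\<^sub>m d"
    unfolding Units_def by (auto simp: ring_mat_simps)
  then show thesis using that minv_eq[OF Xc Y(1,2)] by blast
qed

text \<open>Since X is symmetric, Y^T X = (X Y)^T = 1, hence Y = Y^T X Y is a congruence of X.
  Symmetry of the inverse comes with it.\<close>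

lemma psd_inverse:
  assumes X: "psd_mat d X" and Y: "Y \<in> carrier_mat d d" and XY: "X * Y = 1\<^sub>m d"
  shows "psd_mat d Y"
proof -
  note Xc = psd_matD(1)[OF X]
  have "transpose_mat Y * X = transpose_mat (X * Y)"
    using Xc Y psd_matD(2)[OF X] by (simp add: transpose_mult_dim)
  then have "transpose_mat Y * X * Y = Y" using XY Y by simp
  with psd_congruence[OF X Y] show ?thesis by simp
qed

section \<open>Pseudoinverses and rank\<close>

text \<open>X Y = (X Z)(X Y) holds because X Z X = X. Transposing reverses the order of the two
  symmetric factors, and X Y X = X then collapses the product to X Z. The same argument on the other
  side gives Y X = Z X.\<close>

lemma is_pinv_unique:
  assumes Y: "is_pinv X Y" and Z: "is_pinv X Z"
  shows "Y = Z"
proof -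
  have c: "Y \<in> carrier_mat (dim_col X) (dim_row X)"
    "Z \<in> carrier_mat (dim_col X) (dim_row X)"
    using assms by (auto simp: is_pinv_def)
  note Yd = Y[unfolded is_pinv_def] and Zd = Z[unfolded is_pinv_def]
  have dims: "dim_row Y = dim_col X" "dim_col Y = dim_row X" "dim_row Z = dim_col X"
    "dim_col Z = dim_row X"
    using c by auto
  have "X * Y = (X * Z) * (X * Y)" using Zd dims by (simp add: mult_assoc_dim[symmetric])
  then have "transpose_mat (X * Y) = transpose_mat (X * Y) * transpose_mat (X * Z)"
    using dims by (metis transpose_mult_dim index_mult_mat(2,3))
  also have "\<dots> = X * Y * (X * Z)" using Yd Zd by simp
  also have "\<dots> = X * Z" using Yd dims by (simp add: mult_assoc_dim[symmetric])
  finally have 1: "X * Y = X * Z" using Yd by simp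
  have "Y * X = (Y * X) * (Z * X)" using Zd dims by (simp add: mult_assoc_dim)
  then have "transpose_mat (Y * X) = transpose_mat (Z * X) * transpose_mat (Y * X)"
    using dims by (metis transpose_mult_dim index_mult_mat(2,3))
  also have "\<dots> = Z * X * (Y * X)" using Yd Zd by simp
  also have "\<dots> = Z * X" using Yd dims by (simp add: mult_assoc_dim)
  finally have 2: "Y * X = Z * X" using Yd by simp
  have "Y = Y * X * Y" using Yd by simp
  also have "\<dots> = Z * X * Z" using 1 2 dims by (metis mult_assoc_dim)
  also have "\<dots> = Z" using Zd by simp
  finally show ?thesis .
qed

lemma pinv_eq:
  assumes "is_pinv X Y"
  shows "pinv X = Y"
  unfolding pinv_def using assms is_pinv_unique by blast

lemma self_scalar_prod_pos:
  fixes v :: "real vec"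
  assumes v: "v \<in> carrier_vec d" and "v \<noteq> 0\<^sub>v d"
  shows "0 < v \<bullet> v"
proof -
  obtain i where i: "i < d" "v $ i \<noteq> 0"
    using assms by (metis carrier_vecD eq_vecI index_zero_vec(1,2))
  then have "0 < (\<Sum>j = 0..<d. v $ j * v $ j)"
    by (intro sum_pos2[of _ i]) (auto simp: zero_less_mult_iff)
  then show ?thesis using v by (simp add: scalar_prod_def)
qed

text \<open>Full column rank in kernel form: it transfers between a product and its factors by
  evaluating vectors, without rank inequalities.\<close>

definition injective_mat :: "real mat \<Rightarrow> bool" where
  "injective_mat X \<longleftrightarrow>
     (\<forall>v \<in> carrier_vec (dim_col X). X *\<^sub>v v = 0\<^sub>v (dim_row X) \<longrightarrow> v = 0\<^sub>v (dim_col X))"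

text \<open>For a trivial kernel the Gram matrix X^T X is positive definite, and (X^T X)^-1 X^T
  satisfies the Penrose conditions; symmetry of X Y rests on symmetry of the inverse Gram
  matrix.\<close>

lemma injective_pinv:
  assumes X: "X \<in> carrier_mat nr nc" and inj: "injective_mat X"
  shows "is_pinv X (pinv X)" "pinv X * X = 1\<^sub>m nc" "pinv X \<in> carrier_mat nc nr"
proof -
  \<comment> \<open>The identity serves as the weight, so that
    \<open>quadratic_form_congruence\<close> applies to the Gram matrix.\<close>
  have gram: "transpose_mat X * 1\<^sub>m nr * X = transpose_mat X * X" using X by simp
  have "pd_mat nc (transpose_mat X * X)"
    unfolding pd_mat_def
  proof (intro conjI ballI impI)
    fix v :: "real vec" assume v: "v \<in> carrier_vec nc" and v0: "v \<noteq> 0\<^sub>v nc"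
    then have "X *\<^sub>v v \<noteq> 0\<^sub>v nr" using inj X by (auto simp: injective_mat_def)
    moreover have "X *\<^sub>v v \<in> carrier_vec nr" using X v by auto
    ultimately have "0 < (X *\<^sub>v v) \<bullet> (X *\<^sub>v v)"
      by (intro self_scalar_prod_pos)
    then show "0 < v \<bullet> (transpose_mat X * X *\<^sub>v v)"
      using quadratic_form_congruence[of "1\<^sub>m nr" nr X nc v] X v gram by simp
  qed (use X in \<open>auto simp: transpose_mult_dim\<close>)
  then obtain G where G: "G \<in> carrier_mat nc nc" "transpose_mat X * X * G = 1\<^sub>m nc"
    "G * (transpose_mat X * X) = 1\<^sub>m nc"
    by (rule pd_inverse_exists)
  have "psd_mat nc (transpose_mat X * X)" by (rule pd_imp_psd) fact
  from psd_matD(2)[OF psd_inverse[OF this G(1,2)]] have GT: "transpose_mat G = G" .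
  define Y where "Y = G * transpose_mat X"
  have Yc: "Y \<in> carrier_mat nc nr" using G X by (auto simp: Y_def)
  have YX: "Y * X = 1\<^sub>m nc" using G X by (simp add: Y_def mult_assoc_dim)
  have "is_pinv X Y"
    unfolding is_pinv_def using X Yc G YX GT
    by (auto simp: mult_assoc_dim transpose_mult_dim) (auto simp: Y_def transpose_mult_dim mult_assoc_dim)
  then show "is_pinv X (pinv X)" "pinv X * X = 1\<^sub>m nc" "pinv X \<in> carrier_mat nc nr"
    using pinv_eq YX Yc by auto
qed

lemma injective_square_inverse:
  assumes X: "X \<in> carrier_mat d d" and inj: "injective_mat X"
  obtains Y where "Y \<in> carrier_mat d d" "X * Y = 1\<^sub>m d" "Y * X = 1\<^sub>m d"
  using injective_pinv[OF X inj] mat_mult_left_right_inverse[OF _ X] by metis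

lemma injective_mat_right_factor:
  assumes X: "X \<in> carrier_mat a b" and Y: "Y \<in> carrier_mat b c" and inj: "injective_mat (X * Y)"
  shows "injective_mat Y"
  unfolding injective_mat_def
proof (intro ballI impI)
  fix v assume v: "v \<in> carrier_vec (dim_col Y)" and "Y *\<^sub>v v = 0\<^sub>v (dim_row Y)"
  then have "(X * Y) *\<^sub>v v = 0\<^sub>v a" using X Y by auto
  then show "v = 0\<^sub>v (dim_col Y)" using inj X Y v by (auto simp: injective_mat_def)
qed

text \<open>The right factor is square and injective, hence invertible, so every kernel vector of X
  is Y applied to a kernel vector of X Y. Squareness matters: [1 1] times the column (1, 0) is
  injective, but [1 1] is not.\<close>

lemma injective_mat_left_factor:
  assumes X: "X \<in> carrier_mat a b" and Y: "Y \<in> carrier_mat b b" and inj: "injective_mat (X * Y)"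
  shows "injective_mat X"
  unfolding injective_mat_def
proof (intro ballI impI)
  fix v assume v: "v \<in> carrier_vec (dim_col X)" and Xv: "X *\<^sub>v v = 0\<^sub>v (dim_row X)"
  from injective_square_inverse[OF Y injective_mat_right_factor[OF X Y inj]]
  obtain Z where Z: "Z \<in> carrier_mat b b" "Y * Z = 1\<^sub>m b" by blast
  have YZv: "Y *\<^sub>v (Z *\<^sub>v v) = v"
    using mult_mat_vec_dim[of Y Z v] X Y Z v by simp
  then have "(X * Y) *\<^sub>v (Z *\<^sub>v v) = 0\<^sub>v a"
    using X Y Z v Xv by (simp add: mult_mat_vec_dim)
  then have "Z *\<^sub>v v = 0\<^sub>v b" using inj X Y Z v by (auto simp: injective_mat_def)
  moreover have "Y *\<^sub>v 0\<^sub>v b = 0\<^sub>v b" using Y by auto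
  ultimately show "v = 0\<^sub>v (dim_col X)" using YZv X by simp
qed

text \<open>Links the rank of the library to kernels: a maximal independent set of columns has as
  many elements as the rank, and J selects these columns. It serves both for full column rank and
  for the data matrix, which may have more columns than its rank.\<close>

lemma rank_injective_selection:
  assumes X: "X \<in> carrier_mat nr nc"
  obtains J where "J \<in> carrier_mat nc (vec_space.rank nr X)" "injective_mat (X * J)"
proof -
  interpret vec_space "TYPE(real)" nr .
  obtain S where S: "maximal S (\<lambda>T. T \<subseteq> set (cols X) \<and> lin_indpt T)"
    using maximal_exists[of "(\<lambda>T. T \<subseteq> set (cols X) \<and> lin_indpt T)" "card (set (cols X))" "{}"]
    by (meson List.finite_set card_mono empty_iff empty_subsetI finite_lin_indpt2 rev_finite_subset)
  then have sub: "S \<subseteq> set (cols X)" and ind: "lin_indpt S" by (auto simp: maximal_def)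
  have rank: "rank X = card S" by (rule rank_card_indpt[OF X S])
  from finite_distinct_list[of S] finite_subset[OF sub] obtain vs where
    vs: "set vs = S" "distinct vs" by auto
  have len: "length vs = rank X" using vs rank distinct_card by fastforce
  have vsc: "set vs \<subseteq> carrier_vec nr" using sub vs cols_dim[of X] X by auto
  define Y where "Y = mat_of_cols nr vs"
  have Y: "Y \<in> carrier_mat nr (rank X)" and cols: "cols Y = vs"
    using len vsc by (auto simp: Y_def)
  have injY: "injective_mat Y"
    unfolding injective_mat_def using lin_depI[OF Y] ind vs Y cols by auto
  have "\<exists>j < nc. vs ! i = col X j" if "i < rank X" for i
  proof -
    have "vs ! i \<in> set (cols X)" using that sub vs len by auto
    then show ?thesis using X by (auto simp: in_set_conv_nth)
  qed
  then obtain f where f: "i < rank X \<Longrightarrow> f i < nc \<and> vs ! i = col X (f i)" for i by metis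
  \<comment> \<open>Column i of J is the unit vector at position \<open>f i\<close>, the place of
    the i-th chosen column in X.\<close>
  define J where "J = mat nc (rank X) (\<lambda>(a, i). if a = f i then 1 else 0 :: real)"
  have J: "J \<in> carrier_mat nc (rank X)" by (simp add: J_def)
  have "X * J = Y"
  proof (rule eq_matI)
    fix i j assume "i < dim_row Y" "j < dim_col Y"
    then have ij: "i < nr" "j < rank X" using Y by auto
    have "(X * J) $$ (i, j) = (\<Sum>a = 0..<nc. X $$ (i, a) * (if a = f j then 1 else 0))"
      using ij X by (simp add: J_def scalar_prod_def)
    also have "\<dots> = X $$ (i, f j)" using f[OF ij(2)] by (simp add: if_distrib cong: if_cong)
    also have "\<dots> = Y $$ (i, j)" using f[OF ij(2)] ij X len by (simp add: Y_def mat_of_cols_index)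
    finally show "(X * J) $$ (i, j) = Y $$ (i, j)" .
  qed (use X J Y in auto)
  then show thesis using that J injY by simp
qed

text \<open>At full column rank the selection matrix is square, so injectivity passes to the left
  factor.\<close>

lemma full_column_rank_injective:
  assumes X: "X \<in> carrier_mat nr nc" and "vec_space.rank nr X = nc"
  shows "injective_mat X"
  using rank_injective_selection[OF X] injective_mat_left_factor[OF X] assms(2) by metis

text \<open>The two factorizations say that the ranges agree. Each orthogonal projection then fixes
  the other one under left multiplication; transposing one of these identities makes the projections
  equal.\<close>

lemma pinv_projection_eq:
  assumes X: "is_pinv X X'" and Y: "is_pinv Y Y'"
    and XY: "X = Y * U" "Y = X * V"
    and dims: "dim_col Y = dim_row U" "dim_col X = dim_row V"
  shows "X * X' = Y * Y'"
proof -
  note Xd = X[unfolded is_pinv_def] and Yd = Y[unfolded is_pinv_def]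
  have d: "dim_row X' = dim_col X" "dim_col X' = dim_row X" "dim_row Y' = dim_col Y"
    "dim_col Y' = dim_row Y"
    using Xd Yd by auto
  have r: "dim_row X = dim_row Y" using XY(1) by simp
  have "(Y * Y') * X = X"
  proof -
    have "(Y * Y') * (Y * U) = (Y * Y' * Y) * U" using d dims by (simp add: mult_assoc_dim)
    then show ?thesis using Yd XY(1) by simp
  qed
  then have 1: "(Y * Y') * (X * X') = X * X'" using d r by (simp add: mult_assoc_dim[symmetric])
  have "(X * X') * Y = Y"
  proof -
    have "(X * X') * (X * V) = (X * X' * X) * V" using d dims by (simp add: mult_assoc_dim)
    then show ?thesis using Xd XY(2) by simp
  qed
  then have 2: "(X * X') * (Y * Y') = Y * Y'" using d r by (simp add: mult_assoc_dim[symmetric])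
  have "X * X' = transpose_mat ((Y * Y') * (X * X'))" using 1 Xd by simp
  also have "\<dots> = (X * X') * (Y * Y')" using Xd Yd d r by (simp add: transpose_mult_dim)
  finally show ?thesis using 2 by simp
qed

section \<open>Block matrices\<close>

lemma block_mat_carrier [simp]: "block_mat N K r c f \<in> carrier_mat (N * r) (K * c)"
  by (simp add: block_mat_def)

lemma block_mat_dim [simp]:
  "dim_row (block_mat N K r c f) = N * r" "dim_col (block_mat N K r c f) = K * c"
  by (simp_all add: block_mat_def)

lemma block_mat_index:
  "p < N * r \<Longrightarrow> q < K * c \<Longrightarrow>
    block_mat N K r c f $$ (p, q) = f (p div r + 1) (q div c + 1) $$ (p mod r, q mod c)"
  by (simp add: block_mat_def)

lemma block_mat_cong:
  assumes "\<And>i j. 1 \<le> i \<Longrightarrow> i \<le> N \<Longrightarrow> 1 \<le> j \<Longrightarrow> j \<le> K \<Longrightarrow> f i j = g i j"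
  shows "block_mat N K r c f = block_mat N K r c g"
  by (rule eq_matI) (auto simp: block_mat_index assms less_mult_imp_div_less Suc_le_eq)

lemma block_mat_single:
  assumes "X \<in> carrier_mat r c"
  shows "block_mat 1 1 r c (\<lambda>_ _. X) = X"
  using assms by (intro eq_matI) (auto simp: block_mat_index)

text \<open>An outer product of blocks. The Hankel matrices and \<open>mat_E\<close> have blocks
  whose power of A splits into a row part and a column part, and are factored by this rule.\<close>

lemma block_mat_mult:
  assumes f: "\<And>i. 1 \<le> i \<Longrightarrow> i \<le> N \<Longrightarrow> f i \<in> carrier_mat r s"
    and g: "\<And>j. 1 \<le> j \<Longrightarrow> j \<le> K \<Longrightarrow> g j \<in> carrier_mat s c"
  shows "block_mat N 1 r s (\<lambda>i _. f i) * block_mat 1 K s c (\<lambda>_ j. g j)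
    = block_mat N K r c (\<lambda>i j. f i * g j)"
proof (rule eq_matI)
  fix p q
  assume "p < dim_row (block_mat N K r c (\<lambda>i j. f i * g j))"
    "q < dim_col (block_mat N K r c (\<lambda>i j. f i * g j))"
  then have p: "p < N * r" and q: "q < K * c" by auto
  have r: "0 < r" using p by (cases r) auto
  have c: "0 < c" using q by (cases c) auto
  define i where "i = p div r + 1"
  define j where "j = q div c + 1"
  have fi: "f i \<in> carrier_mat r s"
    using p by (intro f) (auto simp: i_def Suc_le_eq less_mult_imp_div_less)
  have gj: "g j \<in> carrier_mat s c"
    using q by (intro g) (auto simp: j_def Suc_le_eq less_mult_imp_div_less)
  have "(block_mat N 1 r s (\<lambda>i _. f i) * block_mat 1 K s c (\<lambda>_ j. g j)) $$ (p, q)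
    = (\<Sum>a = 0..<s. f i $$ (p mod r, a) * g j $$ (a, q mod c))"
    using p q by (auto simp: scalar_prod_def block_mat_index i_def j_def intro!: sum.cong)
  also have "\<dots> = (f i * g j) $$ (p mod r, q mod c)"
    using fi gj r c by (simp add: scalar_prod_def)
  also have "\<dots> = block_mat N K r c (\<lambda>i j. f i * g j) $$ (p, q)"
    using p q by (simp add: block_mat_index i_def j_def)
  finally show "(block_mat N 1 r s (\<lambda>i _. f i) * block_mat 1 K s c (\<lambda>_ j. g j)) $$ (p, q)
    = block_mat N K r c (\<lambda>i j. f i * g j) $$ (p, q)" .
qed auto

lemma block_col_mult:
  assumes "\<And>i. 1 \<le> i \<Longrightarrow> i \<le> N \<Longrightarrow> f i \<in> carrier_mat r s" and "X \<in> carrier_mat s c"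
  shows "block_mat N 1 r s (\<lambda>i _. f i) * X = block_mat N 1 r c (\<lambda>i _. f i * X)"
  using block_mat_mult[of N f r s 1 "\<lambda>_. X" c] block_mat_single[OF assms(2)] assms by simp

lemma append_cols_mult:
  assumes G: "G \<in> carrier_mat a b" and X: "X \<in> carrier_mat b c" and Y: "Y \<in> carrier_mat b d"
  shows "G * append_cols X Y = append_cols (G * X) (G * Y)"
proof -
  \<comment> \<open>Padding with empty blocks gives G the shape that the product rule for four-block
    matrices expects, since \<open>append_cols\<close> is itself a four-block matrix with empty
    lower blocks.\<close>
  have "G = four_block_mat G (0\<^sub>m a 0) (0\<^sub>m 0 b) (0\<^sub>m 0 0)"
    using G by (intro eq_matI) auto
  then have "G * append_cols X Y
    = four_block_mat G (0\<^sub>m a 0) (0\<^sub>m 0 b) (0\<^sub>m 0 0)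
      * four_block_mat X Y (0\<^sub>m 0 c) (0\<^sub>m 0 d)"
    using X Y by (simp add: append_cols_def)
  also have "\<dots> = append_cols (G * X) (G * Y)"
    using G X Y by (subst mult_four_block_mat[where ?nr1.0 = a and ?nr2.0 = 0 and ?n1.0 = b
      and ?n2.0 = 0 and ?nc1.0 = c and ?nc2.0 = d])
      (auto simp: append_cols_def intro!: cong_four_block_mat)
  finally show ?thesis .
qed

section \<open>Block diagonal matrices and Woodbury's identity\<close>

abbreviation repl_diag :: "nat \<Rightarrow> real mat \<Rightarrow> real mat" where
  "repl_diag N X \<equiv> diag_block_mat (replicate N X)"

lemma repl_diag_carrier:
  assumes "X \<in> carrier_mat r c"
  shows "repl_diag N X \<in> carrier_mat (N * r) (N * c)"
  using assms by (induction N) (auto simp: Let_def)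

lemma repl_diag_Suc:
  assumes X: "X \<in> carrier_mat r c"
  shows "repl_diag (Suc N) X = four_block_mat X (0\<^sub>m r (N * c)) (0\<^sub>m (N * r) c) (repl_diag N X)"
  using X repl_diag_carrier[OF X, of N] by (simp add: Let_def)

lemma block_diag_mult:
  fixes X :: "real mat"
  assumes "X \<in> carrier_mat a a" "X' \<in> carrier_mat a a" "Y \<in> carrier_mat b b" "Y' \<in> carrier_mat b b"
  shows "four_block_mat X (0\<^sub>m a b) (0\<^sub>m b a) Y * four_block_mat X' (0\<^sub>m a b) (0\<^sub>m b a) Y'
    = four_block_mat (X * X') (0\<^sub>m a b) (0\<^sub>m b a) (Y * Y')"
  using assms
  by (subst mult_four_block_mat[where ?nr1.0 = a and ?nr2.0 = b and ?n1.0 = a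
      and ?n2.0 = b and ?nc1.0 = a and ?nc2.0 = b]) auto

lemma repl_diag_inverse:
  assumes X: "X \<in> carrier_mat a a" and Y: "Y \<in> carrier_mat a a" and XY: "X * Y = 1\<^sub>m a"
  shows "repl_diag N X * repl_diag N Y = 1\<^sub>m (N * a)"
proof (induction N)
  case 0
  show ?case by (intro eq_matI) auto
next
  case (Suc N)
  have "repl_diag (Suc N) X * repl_diag (Suc N) Y
    = four_block_mat (X * Y) (0\<^sub>m a (N * a)) (0\<^sub>m (N * a) a) (repl_diag N X * repl_diag N Y)"
    unfolding repl_diag_Suc[OF X] repl_diag_Suc[OF Y]
    by (rule block_diag_mult) (use X Y repl_diag_carrier in auto)
  then show ?case using XY Suc by simp
qed

lemma psd_block_diag:
  assumes X: "psd_mat a X" and Y: "psd_mat b Y"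
  shows "psd_mat (a + b) (four_block_mat X (0\<^sub>m a b) (0\<^sub>m b a) Y)"
  unfolding psd_mat_def
proof (intro conjI ballI)
  note Xc = psd_matD(1)[OF X] and Yc = psd_matD(1)[OF Y]
  show "four_block_mat X (0\<^sub>m a b) (0\<^sub>m b a) Y \<in> carrier_mat (a + b) (a + b)"
    using Xc Yc by simp
  show "transpose_mat (four_block_mat X (0\<^sub>m a b) (0\<^sub>m b a) Y)
    = four_block_mat X (0\<^sub>m a b) (0\<^sub>m b a) Y"
    using Xc Yc psd_matD(2)[OF X] psd_matD(2)[OF Y]
    by (subst transpose_four_block_mat[of _ a a _ b _ b]) auto
  fix v :: "real vec" assume v: "v \<in> carrier_vec (a + b)"
  define x where "x = vec_first v a"
  define y where "y = vec_last v b"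
  have x: "x \<in> carrier_vec a" and y: "y \<in> carrier_vec b" and v_eq: "v = x @\<^sub>v y"
    using v by (simp_all add: x_def y_def)
  have "four_block_mat X (0\<^sub>m a b) (0\<^sub>m b a) Y *\<^sub>v v = (X *\<^sub>v x) @\<^sub>v (Y *\<^sub>v y)"
    unfolding v_eq using Xc Yc x y
    by (subst four_block_mat_mult_vec[of _ a a _ b _ b]) auto
  then have "v \<bullet> (four_block_mat X (0\<^sub>m a b) (0\<^sub>m b a) Y *\<^sub>v v)
    = x \<bullet> (X *\<^sub>v x) + y \<bullet> (Y *\<^sub>v y)"
    unfolding v_eq using Xc Yc x y by (simp add: scalar_prod_append[of _ a _ b])
  then show "0 \<le> v \<bullet> (four_block_mat X (0\<^sub>m a b) (0\<^sub>m b a) Y *\<^sub>v v)"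
    using psd_matD(3)[OF X x] psd_matD(3)[OF Y y] by simp
qed

lemma psd_repl_diag:
  assumes X: "psd_mat a X"
  shows "psd_mat (N * a) (repl_diag N X)"
proof (induction N)
  case 0
  show ?case by (auto simp: psd_mat_def scalar_prod_def)
next
  case (Suc N)
  show ?case
    unfolding repl_diag_Suc[OF psd_matD(1)[OF X]]
    using psd_block_diag[OF X Suc] by simp
qed

text \<open>V, R' and G play the roles of W^-1, R^-1 and (R + M^T W M)^-1. Expanding the product
  leaves 1 - M G X + M R' X - M R' K G X with X = M^T W and K = X M, and the corrections cancel by
  R' = G + R' K G.\<close>

lemma woodbury:
  fixes V W M R R' G :: "real mat"
  assumes c: "V \<in> carrier_mat p p" "W \<in> carrier_mat p p" "M \<in> carrier_mat p q"
      "R \<in> carrier_mat q q" "R' \<in> carrier_mat q q" "G \<in> carrier_mat q q"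
    and VW: "V * W = 1\<^sub>m p" and R': "R' * R = 1\<^sub>m q"
    and G: "(R + transpose_mat M * W * M) * G = 1\<^sub>m q"
  shows "(V + M * R' * transpose_mat M) * (W - W * M * G * transpose_mat M * W) = 1\<^sub>m p"
proof -
  define X where "X = transpose_mat M * W"
  define K where "K = X * M"
  have cX: "X \<in> carrier_mat q p" and cK: "K \<in> carrier_mat q q"
    using c by (auto simp: X_def K_def)
  have G': "(R + K) * G = 1\<^sub>m q" using G by (simp add: X_def K_def)
  \<comment> \<open>The cancellation identity arises from (R + K) G = 1 by multiplying with R' on
    the left.\<close>
  have "R' = R' * ((R + K) * G)" using G' c by simp
  also have "\<dots> = (R' * R) * G + R' * (K * G)"
    using c cK by (simp add: distrib_dim mult_assoc_dim)
  finally have R'_eq: "R' = G + R' * (K * G)" using R' c by simp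
  have W': "W - W * M * G * transpose_mat M * W = W - W * (M * (G * X))"
    using c by (simp add: X_def mult_assoc_dim)
  have 1: "V * (W - W * (M * (G * X))) = 1\<^sub>m p - M * (G * X)"
  proof -
    have "V * (W * (M * (G * X))) = V * W * (M * (G * X))"
      using c cX by (simp add: mult_assoc_dim)
    then show ?thesis using c cX VW by (simp add: distrib_dim)
  qed
  have 2: "transpose_mat M * (W - W * (M * (G * X))) = X - K * (G * X)"
  proof -
    have "transpose_mat M * (W * (M * (G * X))) = transpose_mat M * W * M * (G * X)"
      using c cX by (simp add: mult_assoc_dim)
    then show ?thesis using c cX by (simp add: distrib_dim X_def K_def)
  qed
  have 3: "M * (R' * X) = M * (G * X) + M * (R' * (K * (G * X)))"
  proof -
    have "R' * X = G * X + R' * (K * (G * X))"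
      using c cX cK by (subst R'_eq) (simp add: distrib_dim mult_assoc_dim)
    then show ?thesis using c cX cK by (simp add: distrib_dim)
  qed
  have "(V + M * R' * transpose_mat M) * (W - W * (M * (G * X)))
    = V * (W - W * (M * (G * X))) + M * (R' * (transpose_mat M * (W - W * (M * (G * X)))))"
    using c cX by (simp add: add_mult_distrib_dim mult_assoc_dim)
  also have "\<dots> = 1\<^sub>m p - M * (G * X) + (M * (R' * X) - M * (R' * (K * (G * X))))"
    unfolding 1 2 using c cX cK by (simp add: distrib_dim)
  also have "\<dots> = 1\<^sub>m p"
    unfolding 3 using c cX cK by (intro eq_matI) auto
  finally show ?thesis by (simp add: W')
qed

section \<open>The Riccati recursion in batch form\<close>

text \<open>In the Riccati step X is C and Y holds the later outputs, so the block diagonal weight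
  separates the stage cost C^T Q C from the cost to go.\<close>

lemma append_rows_congruence:
  fixes X Y P R :: "real mat"
  assumes "X \<in> carrier_mat a c" "Y \<in> carrier_mat b c" "P \<in> carrier_mat a a" "R \<in> carrier_mat b b"
  shows "transpose_mat (X @\<^sub>r Y) * four_block_mat P (0\<^sub>m a b) (0\<^sub>m b a) R * (X @\<^sub>r Y)
    = transpose_mat X * P * X + transpose_mat Y * R * Y"
proof -
  have T: "transpose_mat (X @\<^sub>r Y)
    = four_block_mat (transpose_mat X) (transpose_mat Y) (0\<^sub>m 0 a) (0\<^sub>m 0 b)"
    using assms unfolding append_rows_def by (subst transpose_four_block_mat[of _ a c _ 0 _ b]) auto
  have "transpose_mat (X @\<^sub>r Y) * four_block_mat P (0\<^sub>m a b) (0\<^sub>m b a) R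
    = four_block_mat (transpose_mat X * P) (transpose_mat Y * R) (0\<^sub>m 0 a) (0\<^sub>m 0 b)"
    unfolding T using assms
    by (subst mult_four_block_mat[of _ c a _ b _ 0 _ _ a _ b]) auto
  then have "transpose_mat (X @\<^sub>r Y) * four_block_mat P (0\<^sub>m a b) (0\<^sub>m b a) R * (X @\<^sub>r Y)
    = four_block_mat (transpose_mat X * P * X + transpose_mat Y * R * Y) (0\<^sub>m c 0) (0\<^sub>m 0 c) (0\<^sub>m 0 0)"
    using assms unfolding append_rows_def
    by (simp, subst mult_four_block_mat[of _ c a _ b _ 0 _ _ c _ 0])
      (auto intro!: cong_four_block_mat)
  also have "\<dots> = transpose_mat X * P * X + transpose_mat Y * R * Y"
    using assms by (intro eq_matI) auto
  finally show ?thesis .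
qed

lemma pow_mat_add:
  assumes A: "A \<in> carrier_mat n n"
  shows "A ^\<^sub>m (i + j) = A ^\<^sub>m i * A ^\<^sub>m j"
  using A by (induction j) (auto simp: mult_assoc_dim)

section \<open>Extended observability matrix and Markov parameters\<close>

locale lti_system =
  fixes A B C :: "real mat" and n m l :: nat
  assumes A: "A \<in> carrier_mat n n" and B: "B \<in> carrier_mat n m" and C: "C \<in> carrier_mat l n"
begin

text \<open>The number of blocks is independent of the state dimension: n blocks give
  \<open>obsv_mat A C\<close>, and T - t blocks describe the rest of the horizon.\<close>

definition obsv_upto :: "nat \<Rightarrow> real mat" where
  "obsv_upto N = block_mat N 1 l n (\<lambda>i _. C * A ^\<^sub>m (i - 1))"

definition markov_col :: "nat \<Rightarrow> real mat" where
  "markov_col N = block_mat N 1 l m (\<lambda>i _. impulse A B C i)"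

definition markov_toeplitz :: "nat \<Rightarrow> real mat" where
  "markov_toeplitz N = block_mat N N l m (\<lambda>i j. if j < i then impulse A B C (i - j) else 0\<^sub>m l m)"

lemma impulse_carrier [simp]: "impulse A B C s \<in> carrier_mat l m"
  using A B C by (auto simp: impulse_def)

lemma obsv_upto_carrier [simp]: "obsv_upto N \<in> carrier_mat (N * l) n"
  using block_mat_carrier[of N 1 l n] by (simp add: obsv_upto_def)

lemma markov_col_carrier [simp]: "markov_col N \<in> carrier_mat (N * l) m"
  using block_mat_carrier[of N 1 l m] by (simp add: markov_col_def)

lemma markov_toeplitz_carrier [simp]: "markov_toeplitz N \<in> carrier_mat (N * l) (N * m)"
  by (simp add: markov_toeplitz_def)

lemmas markov_dim [simp] = carrier_matD[OF obsv_upto_carrier] carrier_matD[OF markov_col_carrier]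
  carrier_matD[OF markov_toeplitz_carrier]

lemma markov_col_eq: "markov_col N = obsv_upto N * B"
  unfolding markov_col_def obsv_upto_def impulse_def
  by (rule block_col_mult[symmetric]) (use A B C in auto)

lemma obsv_upto_mult_A: "obsv_upto N * A = block_mat N 1 l n (\<lambda>i _. C * A ^\<^sub>m i)"
proof -
  have "obsv_upto N * A = block_mat N 1 l n (\<lambda>i _. C * A ^\<^sub>m (i - 1) * A)"
    unfolding obsv_upto_def by (rule block_col_mult) (use A C in auto)
  also have "\<dots> = block_mat N 1 l n (\<lambda>i _. C * A ^\<^sub>m i)"
  proof (rule block_mat_cong)
    fix i :: nat assume "1 \<le> i"
    then obtain k where "i = Suc k" by (cases i) auto
    then show "C * A ^\<^sub>m (i - 1) * A = C * A ^\<^sub>m i" using A C by (simp add: mult_assoc_dim)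
  qed
  finally show ?thesis .
qed

text \<open>The new block is split off at the top: an earlier output delays all others by one step,
  which is the factor A. This matches a Riccati step, which adds a stage at the front.\<close>

lemma obsv_upto_Suc: "obsv_upto (Suc N) = C @\<^sub>r (obsv_upto N * A)"
proof (rule eq_matI)
  have c: "C @\<^sub>r (obsv_upto N * A) \<in> carrier_mat (l + N * l) n"
    using A C by (intro carrier_append_rows mult_carrier_mat[OF obsv_upto_carrier])
  then show "dim_row (obsv_upto (Suc N)) = dim_row (C @\<^sub>r (obsv_upto N * A))"
    "dim_col (obsv_upto (Suc N)) = dim_col (C @\<^sub>r (obsv_upto N * A))"
    by (simp_all add: obsv_upto_def)
  fix i j
  assume "i < dim_row (C @\<^sub>r (obsv_upto N * A))" "j < dim_col (C @\<^sub>r (obsv_upto N * A))"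
  then have i: "i < l + N * l" and j: "j < n" using c by auto
  then have "0 < l" by (cases l) auto
  show "obsv_upto (Suc N) $$ (i, j) = (C @\<^sub>r (obsv_upto N * A)) $$ (i, j)"
  proof (cases "i < l")
    case True
    then show ?thesis
      using i j A C by (simp add: append_rows_def obsv_upto_mult_A) (simp add: obsv_upto_def block_mat_index)
  next
    case False
    then have "i div l = Suc ((i - l) div l)" "i mod l = (i - l) mod l"
      using \<open>0 < l\<close> by (simp_all add: le_div_geq le_mod_geq)
    then show ?thesis
      using i j A C False
      by (simp add: append_rows_def obsv_upto_mult_A) (simp add: obsv_upto_def block_mat_index)
  qed
qed

text \<open>The first input does not affect the output of its own step and reaches the later ones
  through \<open>markov_col N\<close>. Elsewhere both indices shift by one block, which leaves i - j
  unchanged.\<close>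

lemma markov_toeplitz_Suc:
  "markov_toeplitz (Suc N) = four_block_mat (0\<^sub>m l m) (0\<^sub>m l (N * m)) (markov_col N) (markov_toeplitz N)"
  (is "_ = ?F")
proof (rule eq_matI)
  have c: "?F \<in> carrier_mat (l + N * l) (m + N * m)" by auto
  then show "dim_row (markov_toeplitz (Suc N)) = dim_row ?F"
    "dim_col (markov_toeplitz (Suc N)) = dim_col ?F"
    by (simp_all add: markov_toeplitz_def)
  fix i j
  assume "i < dim_row ?F" "j < dim_col ?F"
  then have i: "i < l + N * l" and j: "j < m + N * m" using c by auto
  then have "0 < l" "0 < m" by (cases l; simp)(use j in \<open>cases m; simp\<close>)
  have Suc: "k div d = Suc ((k - d) div d) \<and> k mod d = (k - d) mod d" if "0 < d" "d \<le> k" for k d :: nat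
    using that by (simp add: le_div_geq le_mod_geq)
  consider "i < l" | "l \<le> i" "j < m" | "l \<le> i" "m \<le> j" by linarith
  then show "markov_toeplitz (Suc N) $$ (i, j) = ?F $$ (i, j)"
  proof cases
    case 1
    then show ?thesis using i j \<open>0 < m\<close> by (auto simp: markov_toeplitz_def block_mat_index)
  next
    case 2
    then show ?thesis using i j Suc[OF \<open>0 < l\<close> 2(1)]
      by (auto simp: markov_toeplitz_def markov_col_def block_mat_index)
  next
    case 3
    then show ?thesis using i j Suc[OF \<open>0 < l\<close> 3(1)] Suc[OF \<open>0 < m\<close> 3(2)]
      by (auto simp: markov_toeplitz_def block_mat_index less_diff_conv2)
  qed
qed

end

section \<open>The batch weight and its inverse\<close>

locale lqr_system = lti_system +
  fixes Q R Q' R' :: "real mat"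
  assumes Q: "psd_mat l Q" and R: "pd_mat m R"
    and Q': "Q' \<in> carrier_mat l l" "Q * Q' = 1\<^sub>m l"
    and R': "R' \<in> carrier_mat m m" "R * R' = 1\<^sub>m m"
begin

text \<open>The weight is defined by the recursion that inverting
  \<open>Q\<^sub>s\<^sup>-\<^sup>1 + S\<^sub>s R\<^sub>s\<^sup>-\<^sup>1 S\<^sub>s\<^sup>T\<close> block by block yields.\<close>

primrec weight :: "nat \<Rightarrow> real mat" where
  "weight 0 = 0\<^sub>m 0 0"
| "weight (Suc N) = four_block_mat Q (0\<^sub>m l (N * l)) (0\<^sub>m (N * l) l)
     (weight N - weight N * markov_col N
        * minv (R + transpose_mat (markov_col N) * weight N * markov_col N)
        * transpose_mat (markov_col N) * weight N)"

text \<open>This is the argument of the outer \<open>minv\<close> in \<open>big_W\<close>, with Q'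
  and R' already in place of the inner inverses.\<close>

definition weight_inv :: "nat \<Rightarrow> real mat" where
  "weight_inv N = repl_diag N Q'
     + markov_toeplitz N * repl_diag N R' * transpose_mat (markov_toeplitz N)"

lemma Q_carrier: "Q \<in> carrier_mat l l" and R_carrier: "R \<in> carrier_mat m m"
  using psd_matD(1)[OF Q] pd_matD(1)[OF R] .

lemma Q'_Q: "Q' * Q = 1\<^sub>m l" and R'_R: "R' * R = 1\<^sub>m m"
  using mat_mult_left_right_inverse Q_carrier R_carrier Q' R' by blast+

text \<open>Semidefiniteness of \<open>weight\<close> is drawn from here by
  \<open>psd_inverse\<close>, as the subtraction in its recursion does not show it.\<close>

lemma psd_weight_inv: "psd_mat (N * l) (weight_inv N)"
proof -
  \<comment> \<open>The double transpose presents S D S^T as a congruence by S^T.\<close>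
  have "psd_mat (N * l) (transpose_mat (transpose_mat (markov_toeplitz N)) * repl_diag N R'
      * transpose_mat (markov_toeplitz N))"
    by (rule psd_congruence[OF psd_repl_diag[OF psd_inverse[OF pd_imp_psd[OF R] R']]]) auto
  then show ?thesis
    unfolding weight_inv_def
    using psd_add[OF psd_repl_diag[OF psd_inverse[OF Q Q']]] by simp
qed

lemma weight_inv_carrier [simp]: "weight_inv N \<in> carrier_mat (N * l) (N * l)"
  using psd_matD(1)[OF psd_weight_inv] .

lemmas weight_inv_dim [simp] = carrier_matD[OF weight_inv_carrier]

text \<open>The off-diagonal blocks vanish because the first block row of the Toeplitz matrix is
  zero. The first input leaves only the update M R' M^T in the lower block, the form that
  \<open>woodbury\<close> inverts.\<close>

lemma weight_inv_Suc:
  "weight_inv (Suc N) = four_block_mat Q' (0\<^sub>m l (N * l)) (0\<^sub>m (N * l) l)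
     (weight_inv N + markov_col N * R' * transpose_mat (markov_col N))"
proof -
  define M where "M = markov_col N"
  define S where "S = markov_toeplitz N"
  define D where "D = repl_diag N R'"
  have c: "M \<in> carrier_mat (N * l) m" "S \<in> carrier_mat (N * l) (N * m)"
      "D \<in> carrier_mat (N * m) (N * m)" "repl_diag N Q' \<in> carrier_mat (N * l) (N * l)"
    using repl_diag_carrier[OF R'(1)] repl_diag_carrier[OF Q'(1)] by (auto simp: M_def S_def D_def)
  have "markov_toeplitz (Suc N) * repl_diag (Suc N) R'
    = four_block_mat (0\<^sub>m l m) (0\<^sub>m l (N * m)) (M * R') (S * D)"
    unfolding markov_toeplitz_Suc repl_diag_Suc[OF R'(1)] M_def[symmetric] S_def[symmetric] D_def[symmetric]
    using c R'(1)
    by (subst mult_four_block_mat[of _ l m _ "N * m" _ "N * l" _ _ m _ "N * m"]) auto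
  moreover have "transpose_mat (markov_toeplitz (Suc N))
    = four_block_mat (0\<^sub>m m l) (transpose_mat M) (0\<^sub>m (N * m) l) (transpose_mat S)"
    unfolding markov_toeplitz_Suc M_def[symmetric] S_def[symmetric] using c
    by (subst transpose_four_block_mat[of _ l m _ "N * m" _ "N * l"]) auto
  ultimately have "markov_toeplitz (Suc N) * repl_diag (Suc N) R' * transpose_mat (markov_toeplitz (Suc N))
    = four_block_mat (0\<^sub>m l l) (0\<^sub>m l (N * l)) (0\<^sub>m (N * l) l)
        (M * R' * transpose_mat M + S * D * transpose_mat S)"
    using c R'(1)
    by (simp, subst mult_four_block_mat[of _ l m _ "N * m" _ "N * l" _ _ l _ "N * l"])
      (auto simp: mult_assoc_dim)
  moreover have "repl_diag N Q' + (M * R' * transpose_mat M + S * D * transpose_mat S)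
    = (repl_diag N Q' + S * D * transpose_mat S) + M * R' * transpose_mat M"
    using c R'(1) by (intro eq_matI) auto
  ultimately show ?thesis
    unfolding weight_inv_def repl_diag_Suc[OF Q'(1)] M_def[symmetric] S_def[symmetric] D_def[symmetric]
    using c Q'(1) R'(1)
    by (simp, subst add_four_block_mat[of _ l l _ "N * l" _ "N * l"]) auto
qed

text \<open>Dimension and inverse are proved together: the \<open>minv\<close> in the next weight
  has a known dimension only if its argument is definite, which needs the current weight to be the
  inverse of a semidefinite matrix.\<close>

lemma weight_carrier_inverse:
  "weight N \<in> carrier_mat (N * l) (N * l) \<and> weight_inv N * weight N = 1\<^sub>m (N * l)"
proof (induction N)
  case 0
  show ?case by (auto intro!: eq_matI)
next
  case (Suc N)
  define M where "M = markov_col N"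
  define G where "G = minv (R + transpose_mat M * weight N * M)"
  have c: "M \<in> carrier_mat (N * l) m" "weight N \<in> carrier_mat (N * l) (N * l)"
    and inv: "weight_inv N * weight N = 1\<^sub>m (N * l)"
    using Suc by (auto simp: M_def)
  have "pd_mat m (R + transpose_mat M * weight N * M)"
    by (rule pd_add_psd[OF R psd_congruence[OF psd_inverse[OF psd_weight_inv c(2) inv] c(1)]])
  then have G: "G \<in> carrier_mat m m" "(R + transpose_mat M * weight N * M) * G = 1\<^sub>m m"
    unfolding G_def by (auto elim: pd_inverse_exists)
  let ?X = "weight N - weight N * M * G * transpose_mat M * weight N"
  have w: "weight (Suc N) = four_block_mat Q (0\<^sub>m l (N * l)) (0\<^sub>m (N * l) l) ?X"
    by (simp add: M_def G_def)
  have X: "?X \<in> carrier_mat (N * l) (N * l)" using c G by auto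
  have "(weight_inv N + M * R' * transpose_mat M) * ?X = 1\<^sub>m (N * l)"
    by (rule woodbury[OF _ c(2,1) R_carrier R'(1) G(1) inv R'_R G(2)]) simp
  then have "weight_inv (Suc N) * weight (Suc N) = 1\<^sub>m (Suc N * l)"
    unfolding w weight_inv_Suc M_def[symmetric]
    using c X Q'(1) Q'_Q Q_carrier R'(1) by (subst block_diag_mult) auto
  moreover have "weight (Suc N) \<in> carrier_mat (Suc N * l) (Suc N * l)"
    unfolding w using X Q_carrier by simp
  ultimately show ?case by simp
qed

lemma weight_carrier [simp]: "weight N \<in> carrier_mat (N * l) (N * l)"
  and weight_inverse: "weight_inv N * weight N = 1\<^sub>m (N * l)"
  using weight_carrier_inverse by auto

lemmas weight_dim [simp] = carrier_matD[OF weight_carrier]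

lemma big_W_eq: "big_W A B C Q R T s = weight (num_blocks T s)"
proof -
  let ?N = "num_blocks T s"
  have 1: "minv (repl_diag ?N Q) = repl_diag ?N Q'"
    by (rule minv_eq[OF _ _ repl_diag_inverse[OF Q_carrier Q']])
      (use Q_carrier Q' repl_diag_carrier in auto)
  have 2: "minv (repl_diag ?N R) = repl_diag ?N R'"
    by (rule minv_eq[OF _ _ repl_diag_inverse[OF R_carrier R']])
      (use R_carrier R' repl_diag_carrier in auto)
  have S: "big_S A B C T s = markov_toeplitz ?N"
    using B C by (simp add: big_S_def markov_toeplitz_def cong: if_cong)
  have "big_W A B C Q R T s = minv (weight_inv ?N)"
    unfolding big_W_def big_diag_def 1 2 S weight_inv_def ..
  also have "\<dots> = weight ?N"
    by (rule minv_eq[OF weight_inv_carrier weight_carrier weight_inverse])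
  finally show ?thesis .
qed

text \<open>With k steps to go there are k + 1 outputs left, the terminal one included; hence
  \<open>Suc k\<close> blocks.\<close>

lemma riccati_eq: "riccati A B C Q R k = transpose_mat (obsv_upto (Suc k)) * weight (Suc k) * obsv_upto (Suc k)"
proof (induction k)
  case 0
  have "obsv_upto (Suc 0) = block_mat 1 1 l n (\<lambda>_ _. C)"
    unfolding obsv_upto_def One_nat_def by (rule block_mat_cong) (use A C in auto)
  then have O1: "obsv_upto (Suc 0) = C" by (simp only: block_mat_single[OF C])
  have "weight (Suc 0) = Q" using Q_carrier by (intro eq_matI) auto
  then show ?case by (simp only: O1 riccati.simps)
next
  case (Suc k)
  let ?N = "Suc k"
  define Ob where "Ob = obsv_upto ?N"
  define W where "W = weight ?N"
  have c: "Ob \<in> carrier_mat (?N * l) n" "W \<in> carrier_mat (?N * l) (?N * l)"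
    unfolding Ob_def W_def by (rule obsv_upto_carrier, rule weight_carrier)
  define P where "P = transpose_mat Ob * W * Ob"
  have P: "P \<in> carrier_mat n n" using c by (auto simp: P_def)
  have IH: "riccati A B C Q R k = P" using Suc by (simp only: P_def Ob_def W_def)
  define G where "G = minv (R + transpose_mat B * P * B)"
  have M: "markov_col ?N = Ob * B" by (simp only: markov_col_eq Ob_def)
  \<comment> \<open>Since the Markov column is Ob B, the matrix inverted in \<open>weight\<close> is
    the very one inverted in \<open>riccati\<close>.\<close>
  have MWM: "transpose_mat (Ob * B) * W * (Ob * B) = transpose_mat B * P * B"
    using c B by (simp add: P_def mult_assoc_dim transpose_mult_dim)
  have "psd_mat (?N * l) W"
    unfolding W_def by (rule psd_inverse[OF psd_weight_inv weight_carrier weight_inverse])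
  then have "psd_mat m (transpose_mat B * P * B)"
    unfolding MWM[symmetric] by (rule psd_congruence) (use c B in auto)
  then have "pd_mat m (R + transpose_mat B * P * B)" by (rule pd_add_psd[OF R])
  then have G: "G \<in> carrier_mat m m" unfolding G_def by (auto elim: pd_inverse_exists)
  let ?X = "W - W * (Ob * B) * G * transpose_mat (Ob * B) * W"
  have X: "?X \<in> carrier_mat (?N * l) (?N * l)" using c B G by auto
  have w: "weight (Suc ?N) = four_block_mat Q (0\<^sub>m l (?N * l)) (0\<^sub>m (?N * l) l) ?X"
    unfolding weight.simps(2)[of ?N] M W_def[symmetric] MWM G_def[symmetric] ..
  have "transpose_mat (obsv_upto (Suc ?N)) * weight (Suc ?N) * obsv_upto (Suc ?N)
    = transpose_mat C * Q * C + transpose_mat (Ob * A) * ?X * (Ob * A)"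
    unfolding w obsv_upto_Suc[of ?N] Ob_def[symmetric]
    by (rule append_rows_congruence) (use A C Q_carrier X c in auto)
  also have "transpose_mat (Ob * A) * ?X * (Ob * A)
    = transpose_mat A * P * A - transpose_mat A * P * B * G * transpose_mat B * P * A"
    using A B c G by (simp add: P_def distrib_dim mult_assoc_dim transpose_mult_dim)
  also have "transpose_mat C * Q * C + \<dots> = \<dots> + transpose_mat C * Q * C"
    by (rule comm_add_mat[of _ n n]) (use A B C P G Q_carrier in auto)
  also have "\<dots> = riccati A B C Q R (Suc k)"
    by (simp add: IH Let_def G_def)
  finally show ?case ..
qed

end

section \<open>The Cayley-Hamilton theorem\<close>

text \<open>Compares the coefficients of x^r in adj(xI - A) (xI - A) = det(xI - A) I;
  \<open>pCons 0\<close> is multiplication by x.\<close>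

lemma char_poly_matrix_adj_coeff:
  fixes A :: "'a :: comm_ring_1 mat"
  assumes A: "A \<in> carrier_mat n n" and i: "i < n" and j: "j < n"
  defines "D \<equiv> adj_mat (char_poly_matrix A)"
  shows "coeff (char_poly A) r * 1\<^sub>m n $$ (i, j)
    = coeff (pCons 0 (D $$ (i, j))) r - (\<Sum>k < n. coeff (D $$ (i, k)) r * A $$ (k, j))"
proof -
  let ?P = "char_poly_matrix A"
  have P: "?P \<in> carrier_mat n n" using A by simp
  have D: "D \<in> carrier_mat n n" unfolding D_def by (rule adj_mat(1)[OF P])
  have "(D * ?P) $$ (i, j) = (\<Sum>k < n. D $$ (i, k) * ?P $$ (k, j))"
    using D P i j by (simp add: scalar_prod_def atLeast0LessThan)
  also have "\<dots> = (\<Sum>k < n. (if k = j then pCons 0 (D $$ (i, k)) else 0) - Polynomial.smult (A $$ (k, j)) (D $$ (i, k)))"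
    using A j by (intro sum.cong) (auto simp: char_poly_matrix_def algebra_simps)
  also have "\<dots> = pCons 0 (D $$ (i, j)) - (\<Sum>k < n. Polynomial.smult (A $$ (k, j)) (D $$ (i, k)))"
    using j by (simp add: sum_subtractf)
  finally have "(D * ?P) $$ (i, j) = \<dots>" .
  moreover have "(D * ?P) $$ (i, j) = Polynomial.smult (1\<^sub>m n $$ (i, j)) (char_poly A)"
    using adj_mat(3)[OF P] i j by (simp add: D_def char_poly_def)
  ultimately have "Polynomial.smult (1\<^sub>m n $$ (i, j)) (char_poly A)
    = pCons 0 (D $$ (i, j)) - (\<Sum>k < n. Polynomial.smult (A $$ (k, j)) (D $$ (i, k)))" by simp
  from arg_cong[OF this, of "\<lambda>p. coeff p r"] show ?thesis
    by (simp add: coeff_sum mult.commute)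
qed

text \<open>Let N_r be the coefficient of x^r in the adjugate and c_r that in the characteristic
  polynomial. Then N_r A = N_(r-1) - c_r I, so c_r A^r = N_(r-1) A^r - N_r A^(r+1) telescopes.
  Working entrywise keeps the sums in the ring of entries.\<close>

lemma cayley_hamilton_entry:
  fixes A :: "'a :: comm_ring_1 mat"
  assumes A: "A \<in> carrier_mat n n" and i: "i < n" and j: "j < n"
  shows "(\<Sum>r \<le> n. coeff (char_poly A) r * (A ^\<^sub>m r) $$ (i, j)) = 0"
proof -
  define D where "D = adj_mat (char_poly_matrix A)"
  define N where "N r = mat n n (\<lambda>(i, j). coeff (D $$ (i, j)) r)" for r
  have N: "N r \<in> carrier_mat n n" for r by (simp add: N_def)
  have NA: "N r * A = (if r = 0 then 0\<^sub>m n n else N (r - 1)) - coeff (char_poly A) r \<cdot>\<^sub>m 1\<^sub>m n" for r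
  proof (rule eq_matI)
    fix i j
    assume "i < dim_row ((if r = 0 then 0\<^sub>m n n else N (r - 1)) - coeff (char_poly A) r \<cdot>\<^sub>m 1\<^sub>m n)"
      "j < dim_col ((if r = 0 then 0\<^sub>m n n else N (r - 1)) - coeff (char_poly A) r \<cdot>\<^sub>m 1\<^sub>m n)"
    then have ij: "i < n" "j < n" by auto
    have "(N r * A) $$ (i, j) = (\<Sum>k < n. coeff (D $$ (i, k)) r * A $$ (k, j))"
      using A ij by (simp add: N_def scalar_prod_def atLeast0LessThan)
    also have "\<dots> = coeff (pCons 0 (D $$ (i, j))) r - coeff (char_poly A) r * 1\<^sub>m n $$ (i, j)"
      using char_poly_matrix_adj_coeff[OF A ij, of r] by (simp add: D_def)
    also have "\<dots> = ((if r = 0 then 0\<^sub>m n n else N (r - 1)) - coeff (char_poly A) r \<cdot>\<^sub>m 1\<^sub>m n) $$ (i, j)"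
      using ij by (cases r) (auto simp: N_def)
    finally show "(N r * A) $$ (i, j) = \<dots>" .
  qed (use A in \<open>auto simp: N_def\<close>)
  have telescope: "(\<Sum>r \<le> d. coeff (char_poly A) r * (A ^\<^sub>m r) $$ (i, j))
    = - (N d * A ^\<^sub>m (d + 1)) $$ (i, j)" for d
  proof (induction d)
    case 0
    show ?case using A N[of 0] NA[of 0] i j by simp
  next
    case (Suc d)
    have A1: "A ^\<^sub>m 1 = A" using A by simp
    have "Suc d + 1 = 1 + (d + 1)" by simp
    then have pow: "A ^\<^sub>m (Suc d + 1) = A * A ^\<^sub>m (d + 1)"
      by (simp only: pow_mat_add[OF A] A1)
    have "N (Suc d) * A ^\<^sub>m (Suc d + 1) = N (Suc d) * A * A ^\<^sub>m (d + 1)"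
      unfolding pow using A N by (simp add: mult_assoc_dim carrier_matD[OF N])
    also have "\<dots> = N d * A ^\<^sub>m (d + 1) - coeff (char_poly A) (Suc d) \<cdot>\<^sub>m 1\<^sub>m n * A ^\<^sub>m (d + 1)"
      unfolding NA using A N[of d] by (subst minus_mult_distrib_mat[of _ n n]) auto
    also have "coeff (char_poly A) (Suc d) \<cdot>\<^sub>m 1\<^sub>m n * A ^\<^sub>m (d + 1)
      = coeff (char_poly A) (Suc d) \<cdot>\<^sub>m A ^\<^sub>m (d + 1)"
      using A by (subst mult_smult_assoc_mat[of _ n n _ n]) auto
    finally have "(N (Suc d) * A ^\<^sub>m (Suc d + 1)) $$ (i, j)
      = (N d * A ^\<^sub>m (d + 1)) $$ (i, j) - coeff (char_poly A) (Suc d) * (A ^\<^sub>m (d + 1)) $$ (i, j)"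
      using A i j by simp
    then show ?case using Suc by simp
  qed
  \<comment> \<open>A crude bound: d exceeds the degrees of all entries of the adjugate, so N_d
    vanishes, and d is at least n, so the sum can be cut back to n.\<close>
  define d where "d = n + (\<Sum>i < n. \<Sum>j < n. Suc (degree (D $$ (i, j))))"
  have "N d = 0\<^sub>m n n"
  proof (rule eq_matI)
    fix i j assume "i < dim_row (0\<^sub>m n n)" "j < dim_col (0\<^sub>m n n)"
    then have ij: "i < n" "j < n" by auto
    have "Suc (degree (D $$ (i, j))) \<le> (\<Sum>j < n. Suc (degree (D $$ (i, j))))"
      using ij by (intro member_le_sum) auto
    also have "\<dots> \<le> (\<Sum>i < n. \<Sum>j < n. Suc (degree (D $$ (i, j))))"
      using ij by (intro member_le_sum[of i _ "\<lambda>i. \<Sum>j < n. Suc (degree (D $$ (i, j)))"]) auto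
    finally have "degree (D $$ (i, j)) < d" by (simp add: d_def)
    then show "N d $$ (i, j) = 0\<^sub>m n n $$ (i, j)" using ij by (simp add: N_def coeff_eq_0)
  qed (auto simp: N_def)
  then have "(\<Sum>r \<le> d. coeff (char_poly A) r * (A ^\<^sub>m r) $$ (i, j)) = 0"
    using A i j by (simp add: telescope del: pow_mat.simps)
  also have "(\<Sum>r \<le> d. coeff (char_poly A) r * (A ^\<^sub>m r) $$ (i, j))
    = (\<Sum>r \<le> n. coeff (char_poly A) r * (A ^\<^sub>m r) $$ (i, j))"
    using degree_monic_char_poly[OF A]
    by (intro sum.mono_neutral_right) (auto simp: d_def coeff_eq_0)
  finally show ?thesis .
qed

lemma triple_mult_index:
  fixes X M Y :: "'a :: comm_semiring_0 mat"
  assumes "X \<in> carrier_mat a n" "M \<in> carrier_mat n n'" "Y \<in> carrier_mat n' b" "i < a" "j < b"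
  shows "(X * M * Y) $$ (i, j) = (\<Sum>p < n. \<Sum>s < n'. X $$ (i, p) * Y $$ (s, j) * M $$ (p, s))"
  using assms by (simp add: scalar_prod_def atLeast0LessThan sum_distrib_left mult_ac)

text \<open>Each entry of X A^q Y is a fixed linear combination of the entries of A^q. The
  characteristic polynomial is monic, which isolates the term with A^n.\<close>

lemma cayley_hamilton_sandwich:
  fixes A X Y :: "'a :: comm_ring_1 mat"
  assumes A: "A \<in> carrier_mat n n" and X: "X \<in> carrier_mat a n" and Y: "Y \<in> carrier_mat n b"
    and i: "i < a" and j: "j < b"
  shows "(X * A ^\<^sub>m n * Y) $$ (i, j)
    = - (\<Sum>q < n. coeff (char_poly A) q * (X * A ^\<^sub>m q * Y) $$ (i, j))"
proof -
  have "(\<Sum>q \<le> n. coeff (char_poly A) q * (X * A ^\<^sub>m q * Y) $$ (i, j))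
    = (\<Sum>q \<le> n. \<Sum>p < n. \<Sum>s < n. X $$ (i, p) * Y $$ (s, j) * (coeff (char_poly A) q * (A ^\<^sub>m q) $$ (p, s)))"
    using A by (simp add: triple_mult_index[OF X _ Y i j, of "A ^\<^sub>m _"] sum_distrib_left mult_ac)
  also have "\<dots> = (\<Sum>p < n. \<Sum>q \<le> n. \<Sum>s < n. X $$ (i, p) * Y $$ (s, j) * (coeff (char_poly A) q * (A ^\<^sub>m q) $$ (p, s)))"
    by (rule sum.swap)
  also have "\<dots> = (\<Sum>p < n. \<Sum>s < n. \<Sum>q \<le> n. X $$ (i, p) * Y $$ (s, j) * (coeff (char_poly A) q * (A ^\<^sub>m q) $$ (p, s)))"
    by (intro sum.cong refl sum.swap)
  also have "\<dots> = 0"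
    using cayley_hamilton_entry[OF A] by (simp flip: sum_distrib_left)
  finally show ?thesis
    using degree_monic_char_poly[OF A]
    by (simp add: lessThan_Suc_atMost[symmetric] eq_neg_iff_add_eq_0 add.commute)
qed

section \<open>Reconstruction from impulse responses\<close>

text \<open>The inner index splits into n groups of length l; within each group the identity factor
  keeps only row i.\<close>

lemma kron_one_mult_stack:
  fixes \<alpha> :: "real mat"
  assumes \<alpha>: "\<alpha> \<in> carrier_mat 1 n" and len: "length Xs = n" and i: "i < l" and j: "j < c"
  shows "(kron \<alpha> (1\<^sub>m l) * stack l c Xs) $$ (i, j) = (\<Sum>q < n. \<alpha> $$ (0, q) * (Xs ! q) $$ (i, j))"
proof -
  define g where "g p = \<alpha> $$ (0, p div l) * 1\<^sub>m l $$ (i, p mod l) * (Xs ! (p div l)) $$ (p mod l, j)" for p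
  have "(kron \<alpha> (1\<^sub>m l) * stack l c Xs) $$ (i, j) = (\<Sum>p < n * l. g p)"
    using assms
    by (auto simp: g_def kron_def stack_def scalar_prod_def block_mat_index atLeast0LessThan intro!: sum.cong)
  also have "\<dots> = (\<Sum>q < n. sum g {q * l..<q * l + l})"
    by (rule sum.nat_group[symmetric])
  also have "\<dots> = (\<Sum>q < n. \<alpha> $$ (0, q) * (Xs ! q) $$ (i, j))"
  proof (rule sum.cong[OF refl])
    fix q assume "q \<in> {..<n}"
    have "sum g {q * l..<q * l + l} = (\<Sum>s < l. g (q * l + s))"
      by (simp add: sum.atLeastLessThan_shift_0 atLeast0LessThan add.commute)
    also have "\<dots> = (\<Sum>s < l. if s = i then \<alpha> $$ (0, q) * (Xs ! q) $$ (s, j) else 0)"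
      using i by (intro sum.cong) (auto simp: g_def)
    also have "\<dots> = \<alpha> $$ (0, q) * (Xs ! q) $$ (i, j)" using i by simp
    finally show "sum g {q * l..<q * l + l} = \<alpha> $$ (0, q) * (Xs ! q) $$ (i, j)" .
  qed
  finally show ?thesis .
qed

context lti_system
begin

lemma block_row_obsv:
  assumes Y: "Y \<in> carrier_mat n c" and k: "k < n'"
  shows "block_row l (obsv_upto n' * Y) k = C * A ^\<^sub>m k * Y"
proof (rule eq_matI)
  have eq: "obsv_upto n' * Y = block_mat n' 1 l c (\<lambda>i _. C * A ^\<^sub>m (i - 1) * Y)"
    unfolding obsv_upto_def by (rule block_col_mult) (use A C Y in auto)
  fix i j assume "i < dim_row (C * A ^\<^sub>m k * Y)" "j < dim_col (C * A ^\<^sub>m k * Y)"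
  then have ij: "i < l" "j < c" using C Y by auto
  have "k * l + i < Suc k * l" using ij by simp
  also have "\<dots> \<le> n' * l" using k by (intro mult_le_mono1) simp
  finally show "block_row l (obsv_upto n' * Y) k $$ (i, j) = (C * A ^\<^sub>m k * Y) $$ (i, j)"
    using ij Y unfolding block_row_def eq by (simp add: block_mat_index)
qed (use C Y in \<open>auto simp: block_row_def\<close>)

lemma F_seq_eq:
  assumes Y: "Y \<in> carrier_mat n c"
  shows "F_seq n l (kron (char_coeffs A) (1\<^sub>m l)) (obsv_upto n * Y) k = C * A ^\<^sub>m k * Y"
proof (induction k rule: less_induct)
  case (less k)
  show ?case
  proof (cases "k < n")
    case True
    then show ?thesis using block_row_obsv[OF Y] by (simp add: F_seq.simps[of _ _ _ _ k])
  next
    case False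
    let ?K = "kron (char_coeffs A) (1\<^sub>m l)"
    let ?Xs = "map (\<lambda>k. C * A ^\<^sub>m k * Y) [k - n..<k]"
    have \<alpha>: "char_coeffs A \<in> carrier_mat 1 n" using A by (simp add: char_coeffs_def)
    have map_eq: "map (F_seq n l ?K (obsv_upto n * Y)) [k - n..<k] = ?Xs"
      using less.IH by simp
    have F: "F_seq n l ?K (obsv_upto n * Y) k = - (?K * stack l c ?Xs)"
      using False Y by (simp add: F_seq.simps[of _ _ _ _ k] map_eq)
    show ?thesis
      unfolding F
    proof (rule eq_matI)
      fix i j assume "i < dim_row (C * A ^\<^sub>m k * Y)" "j < dim_col (C * A ^\<^sub>m k * Y)"
      then have ij: "i < l" "j < c" using C Y by auto
      \<comment> \<open>All members of the window of length n share the left factor C A^(k-n), so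
        the recursion becomes one instance of Cayley-Hamilton.\<close>
      have pow: "C * A ^\<^sub>m (k - n) * A ^\<^sub>m q * Y = C * A ^\<^sub>m (k - n + q) * Y" for q
        using A C Y by (simp add: pow_mat_add[OF A] mult_assoc_dim)
      have "(?K * stack l c ?Xs) $$ (i, j)
        = (\<Sum>q < n. coeff (char_poly A) q * (C * A ^\<^sub>m (k - n) * A ^\<^sub>m q * Y) $$ (i, j))"
        using False A unfolding pow
        by (subst kron_one_mult_stack[OF \<alpha> _ ij]) (auto simp: char_coeffs_def intro!: sum.cong)
      then have "(?K * stack l c ?Xs) $$ (i, j) = - (C * A ^\<^sub>m k * Y) $$ (i, j)"
        using cayley_hamilton_sandwich[OF A _ Y ij, of "C * A ^\<^sub>m (k - n)"] A C False pow[of n] by simp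
      then show "(- (?K * stack l c ?Xs)) $$ (i, j) = (C * A ^\<^sub>m k * Y) $$ (i, j)"
        using ij \<alpha> by (simp add: kron_def stack_def)
    qed (use \<alpha> C Y in \<open>auto simp: kron_def stack_def\<close>)
  qed
qed

text \<open>The list begins with F_1 and omits F_0; this shift is the additional factor A after the
  observability matrix.\<close>

lemma stack_F_eq:
  assumes Y: "Y \<in> carrier_mat n c"
    and G: "\<And>i. G (n + i) = C * A ^\<^sub>m (n + i) * Y"
  shows "stack l c (map (\<lambda>i. G (n + i)) [1..<N + 1]) = obsv_upto N * A * (A ^\<^sub>m n * Y)"
proof -
  have "obsv_upto N * A * (A ^\<^sub>m n * Y) = block_mat N 1 l c (\<lambda>i _. C * A ^\<^sub>m i * (A ^\<^sub>m n * Y))"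
    unfolding obsv_upto_mult_A by (rule block_col_mult) (use A C Y in auto)
  also have "\<dots> = block_mat N 1 l c (\<lambda>i _. map (\<lambda>i. G (n + i)) [1..<N + 1] ! (i - 1))"
  proof (rule block_mat_cong)
    fix i :: nat assume "1 \<le> i" "i \<le> N"
    then have "map (\<lambda>i. G (n + i)) [1..<N + 1] ! (i - 1) = C * A ^\<^sub>m (n + i) * Y"
      by (subst nth_map) (auto simp: G nth_upt simp del: upt_Suc)
    then show "C * A ^\<^sub>m i * (A ^\<^sub>m n * Y) = map (\<lambda>i. G (n + i)) [1..<N + 1] ! (i - 1)"
      using A C Y pow_mat_add[OF A, of i n] by (simp add: mult_assoc_dim add.commute del: upt_Suc)
  qed
  finally show ?thesis by (simp add: stack_def del: upt_Suc)
qed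

lemma mat_E_eq: "mat_E A B C T t = obsv_upto (T - t) * A * ctrb_mat A B"
proof -
  have "obsv_upto (T - t) * A * ctrb_mat A B
    = block_mat (T - t) n l m (\<lambda>i j. C * A ^\<^sub>m i * (A ^\<^sub>m (n - j) * B))"
    unfolding obsv_upto_mult_A ctrb_mat_def
    using A B C by (simp only: carrier_matD) (intro block_mat_mult, auto)
  also have "\<dots> = block_mat (T - t) n l m (\<lambda>i j. impulse A B C (n + 1 + i - j))"
  proof (rule block_mat_cong)
    fix i j :: nat assume "1 \<le> i" "j \<le> n"
    \<comment> \<open>Since j is at most n, no subtraction truncates, and the exponent splits into
      the power in block row i and the power n - j of the controllability matrix.\<close>
    then have "n + 1 + i - j - 1 = i + (n - j)" by simp
    then show "C * A ^\<^sub>m i * (A ^\<^sub>m (n - j) * B) = impulse A B C (n + 1 + i - j)"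
      using A B C unfolding impulse_def by (simp only: pow_mat_add[OF A]) (simp add: mult_assoc_dim)
  qed
  finally show ?thesis using A B C by (simp add: mat_E_def)
qed

text \<open>The Ho-Kalman factorization; the right factor lists ascending powers of A, opposite to
  the order in \<open>ctrb_mat\<close>.\<close>

lemma data_hankel_eq:
  "data_hankel A B C k = obsv_upto n * block_mat 1 k n m (\<lambda>_ j. A ^\<^sub>m (j - 1) * B)"
proof -
  have "obsv_upto n * block_mat 1 k n m (\<lambda>_ j. A ^\<^sub>m (j - 1) * B)
    = block_mat n k l m (\<lambda>i j. C * A ^\<^sub>m (i - 1) * (A ^\<^sub>m (j - 1) * B))"
    unfolding obsv_upto_def by (rule block_mat_mult) (use A B C in auto)
  also have "\<dots> = block_mat n k l m (\<lambda>i j. impulse A B C (i + j - 1))"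
  proof (rule block_mat_cong)
    fix i j :: nat assume "1 \<le> i" "1 \<le> j"
    then have "i + j - 1 - 1 = (i - 1) + (j - 1)" by simp
    then show "C * A ^\<^sub>m (i - 1) * (A ^\<^sub>m (j - 1) * B) = impulse A B C (i + j - 1)"
      using A B C unfolding impulse_def by (simp only: pow_mat_add[OF A]) (simp add: mult_assoc_dim)
  qed
  finally show ?thesis using A B C by (simp add: data_hankel_def)
qed

section \<open>Coefficients and observable range recovered from data\<close>

lemma impulse_col_eq:
  assumes "j < m"
  shows "impulse_col A B C j s = C * A ^\<^sub>m (s - 1) * mat_of_cols n [col B j]"
  using assms A B C
  by (intro eq_matI) (auto simp: impulse_col_def impulse_def mat_of_cols_def scalar_prod_def intro!: sum.cong)

text \<open>With b the chosen column of B, Cayley-Hamilton writes A^n b as minus the Krylov matrix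
  of b times the coefficient column. Applying the observability matrix turns the data column into
  minus the Hankel matrix times that column, and full column rank lets the pseudoinverse cancel the
  Hankel matrix.\<close>

lemma data_coeffs_eq:
  assumes j: "j < m" and rank: "vec_space.rank (n * l) (col_hankel A B C j) = n"
  shows "data_coeffs A B C j = char_coeffs A"
proof -
  define b where "b = mat_of_cols n [col B j]"
  have b: "b \<in> carrier_mat n 1"
    using mat_of_cols_carrier(1)[of n "[col B j]"] by (simp add: b_def)
  define \<Gamma> where "\<Gamma> = block_mat 1 n n 1 (\<lambda>_ q. A ^\<^sub>m (q - 1) * b)"
  define a where "a = transpose_mat (char_coeffs A)"
  have a: "a \<in> carrier_mat n 1" using A by (simp add: a_def char_coeffs_def)
  have \<Gamma>: "\<Gamma> \<in> carrier_mat n n" using block_mat_carrier[of 1 n n 1] by (simp add: \<Gamma>_def)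
  note imp = impulse_col_eq[OF j, folded b_def]
  have H: "col_hankel A B C j = obsv_upto n * \<Gamma>"
  proof -
    have "obsv_upto n * \<Gamma> = block_mat n n l 1 (\<lambda>p q. C * A ^\<^sub>m (p - 1) * (A ^\<^sub>m (q - 1) * b))"
      unfolding obsv_upto_def \<Gamma>_def by (rule block_mat_mult) (use A b C in auto)
    also have "\<dots> = block_mat n n l 1 (\<lambda>p q. impulse_col A B C j (p + q - 1))"
    proof (rule block_mat_cong)
      fix p q :: nat assume "1 \<le> p" "1 \<le> q"
      then have "p + q - 1 - 1 = (p - 1) + (q - 1)" by simp
      then show "C * A ^\<^sub>m (p - 1) * (A ^\<^sub>m (q - 1) * b) = impulse_col A B C j (p + q - 1)"
        using A b C unfolding imp by (simp only: pow_mat_add[OF A]) (simp add: mult_assoc_dim)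
    qed
    finally show ?thesis using A C by (simp add: col_hankel_def)
  qed
  have rhs: "block_mat n 1 l 1 (\<lambda>p _. impulse_col A B C j (n + p)) = obsv_upto n * (A ^\<^sub>m n * b)"
  proof -
    have "obsv_upto n * (A ^\<^sub>m n * b) = block_mat n 1 l 1 (\<lambda>p _. C * A ^\<^sub>m (p - 1) * (A ^\<^sub>m n * b))"
      unfolding obsv_upto_def by (rule block_col_mult) (use A b C in auto)
    also have "\<dots> = block_mat n 1 l 1 (\<lambda>p _. impulse_col A B C j (n + p))"
    proof (rule block_mat_cong)
      fix p :: nat assume "1 \<le> p"
      then have "n + p - 1 = (p - 1) + n" by simp
      then show "C * A ^\<^sub>m (p - 1) * (A ^\<^sub>m n * b) = impulse_col A B C j (n + p)"
        using A b C unfolding imp by (simp only: pow_mat_add[OF A]) (simp add: mult_assoc_dim)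
    qed
    finally show ?thesis ..
  qed
  have ch: "A ^\<^sub>m n * b = - (\<Gamma> * a)"
  proof (rule eq_matI)
    fix i q assume "i < dim_row (- (\<Gamma> * a))" "q < dim_col (- (\<Gamma> * a))"
    then have i: "i < n" and q: "q = 0" using \<Gamma> a by auto
    have "(1\<^sub>m n * A ^\<^sub>m n * b) $$ (i, 0)
      = - (\<Sum>q < n. coeff (char_poly A) q * (1\<^sub>m n * A ^\<^sub>m q * b) $$ (i, 0))"
      by (rule cayley_hamilton_sandwich[OF A _ b i]) auto
    then have "(A ^\<^sub>m n * b) $$ (i, 0) = - (\<Sum>q < n. coeff (char_poly A) q * (A ^\<^sub>m q * b) $$ (i, 0))"
      using A by (simp add: one_mult_dim)
    also have "(\<Sum>q < n. coeff (char_poly A) q * (A ^\<^sub>m q * b) $$ (i, 0)) = (\<Gamma> * a) $$ (i, 0)"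
      using i \<Gamma> a A
      by (auto simp: \<Gamma>_def a_def char_coeffs_def scalar_prod_def block_mat_index atLeast0LessThan
          intro!: sum.cong simp flip: One_nat_def)
    finally show "(A ^\<^sub>m n * b) $$ (i, q) = (- (\<Gamma> * a)) $$ (i, q)" using i q \<Gamma> a by simp
  qed (use A b \<Gamma> a in auto)
  have Hc: "col_hankel A B C j \<in> carrier_mat (n * l) n" unfolding H using \<Gamma> by auto
  note inj = injective_pinv[OF Hc full_column_rank_injective[OF Hc rank]]
  have "pinv (col_hankel A B C j) * (obsv_upto n * (A ^\<^sub>m n * b))
    = - (pinv (col_hankel A B C j) * col_hankel A B C j * a)"
    unfolding ch H using inj(3)[unfolded H] \<Gamma> a
    by (simp add: mult_assoc_dim)
  also have "\<dots> = - a" using inj(2) a by simp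
  finally show ?thesis
    using A C unfolding data_coeffs_def by (simp add: rhs[unfolded One_nat_def] a_def)
qed

lemma is_coeffs_eq:
  assumes "is_coeffs A B C \<alpha>"
  shows "\<alpha> = char_coeffs A"
  using assms A B C data_coeffs_eq unfolding is_coeffs_def by auto

text \<open>Both matrices are left factors of D. Restricted to n independent columns of D, the right
  factors become invertible n by n matrices, so each left factor is a multiple of the other and the
  ranges coincide.\<close>

lemma QR_projection:
  assumes rank: "vec_space.rank (n * l) (data_hankel A B C k) = n"
    and QR: "is_QR (data_hankel A B C k) L H" and l: "0 < l"
    and obsv: "injective_mat (obsv_upto n)"
  defines "O\<^sub>L \<equiv> mat_of_cols (n * l) (take n (cols L))"
  shows "O\<^sub>L * pinv O\<^sub>L = obsv_upto n * pinv (obsv_upto n)"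
proof -
  define D where "D = data_hankel A B C k"
  define \<Gamma> where "\<Gamma> = block_mat 1 k n m (\<lambda>_ j. A ^\<^sub>m (j - 1) * B)"
  have \<Gamma>: "\<Gamma> \<in> carrier_mat n (k * m)" using block_mat_carrier[of 1 k n m] by (simp add: \<Gamma>_def)
  have D\<Gamma>: "D = obsv_upto n * \<Gamma>" by (simp only: D_def \<Gamma>_def data_hankel_eq)
  have D: "D \<in> carrier_mat (n * l) (k * m)" using D\<Gamma> \<Gamma> by auto
  note QR' = QR[folded D_def, unfolded is_QR_def carrier_matD[OF D] rank[folded D_def]]
  have L: "L \<in> carrier_mat (n * l) (n * l)" and H: "H \<in> carrier_mat (n * l) (k * m)" using QR' by auto
  have nl: "n \<le> n * l" using l by simp
  have "length (take n (cols L)) = n" using L nl by (simp only: length_take cols_length carrier_matD min_absorb1)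
  then have OL: "O\<^sub>L \<in> carrier_mat (n * l) n"
    using mat_of_cols_carrier(1)[of "n * l" "take n (cols L)"] by (simp only: O\<^sub>L_def)
  define H\<^sub>1 where "H\<^sub>1 = mat n (k * m) (\<lambda>(i, j). H $$ (i, j))"
  have H1: "H\<^sub>1 \<in> carrier_mat n (k * m)" by (simp add: H\<^sub>1_def)
  have DH: "D = O\<^sub>L * H\<^sub>1"
  proof (rule eq_matI)
    fix i j assume "i < dim_row (O\<^sub>L * H\<^sub>1)" "j < dim_col (O\<^sub>L * H\<^sub>1)"
    then have i: "i < n * l" and j: "j < k * m" using OL H1 by auto
    have "D $$ (i, j) = (\<Sum>a < n * l. L $$ (i, a) * H $$ (a, j))"
      using QR' L H i j by (simp add: scalar_prod_def atLeast0LessThan)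
    \<comment> \<open>The trapezoidal form of H enters here: its rows from the rank n onwards are
      zero.\<close>
    also have "\<dots> = (\<Sum>a < n. L $$ (i, a) * H $$ (a, j))"
      using QR' j nl by (intro sum.mono_neutral_right) auto
    also have "\<dots> = (\<Sum>a < n. O\<^sub>L $$ (i, a) * H\<^sub>1 $$ (a, j))"
    proof (rule sum.cong[OF refl])
      fix a assume "a \<in> {..<n}"
      then have "a < n" "a < n * l" using order.strict_trans2[OF _ nl, of a] by auto
      then show "L $$ (i, a) * H $$ (a, j) = O\<^sub>L $$ (i, a) * H\<^sub>1 $$ (a, j)"
        using L i j by (simp add: O\<^sub>L_def H\<^sub>1_def mat_of_cols_index)
    qed
    also have "\<dots> = (O\<^sub>L * H\<^sub>1) $$ (i, j)"
      using OL H1 i j by (simp add: scalar_prod_def atLeast0LessThan)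
    finally show "D $$ (i, j) = (O\<^sub>L * H\<^sub>1) $$ (i, j)" .
  qed (use D OL H1 in auto)
  from rank_injective_selection[OF D] rank obtain J where
    J: "J \<in> carrier_mat (k * m) n" "injective_mat (D * J)" by (auto simp: D_def)
  define X where "X = \<Gamma> * J"
  define Y where "Y = H\<^sub>1 * J"
  have X: "X \<in> carrier_mat n n" and Y: "Y \<in> carrier_mat n n"
    using \<Gamma> H1 J by (auto simp: X_def Y_def)
  have DX: "D * J = obsv_upto n * X" using \<Gamma> J by (simp add: D\<Gamma> X_def mult_assoc_dim)
  have DY: "D * J = O\<^sub>L * Y" using OL H1 J by (simp add: DH Y_def mult_assoc_dim)
  from injective_square_inverse[OF X injective_mat_right_factor[OF obsv_upto_carrier X]] J(2) DX
  obtain X' where X': "X' \<in> carrier_mat n n" "X * X' = 1\<^sub>m n" by auto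
  from injective_square_inverse[OF Y injective_mat_right_factor[OF OL Y]] J(2) DY
  obtain Y' where Y': "Y' \<in> carrier_mat n n" "Y * Y' = 1\<^sub>m n" by auto
  have "obsv_upto n = obsv_upto n * (X * X')" using X' by simp
  also have "\<dots> = (D * J) * X'" unfolding DX using X X' by (simp add: mult_assoc_dim)
  also have "\<dots> = O\<^sub>L * (Y * X')" unfolding DY using OL Y X' by (simp add: mult_assoc_dim)
  finally have 1: "obsv_upto n = O\<^sub>L * (Y * X')" .
  have "O\<^sub>L = O\<^sub>L * (Y * Y')" using Y' OL by simp
  also have "\<dots> = (D * J) * Y'" unfolding DY using OL Y Y' by (simp add: mult_assoc_dim)
  also have "\<dots> = obsv_upto n * (X * Y')" unfolding DX using X Y' by (simp add: mult_assoc_dim)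
  finally have 2: "O\<^sub>L = obsv_upto n * (X * Y')" .
  have "injective_mat O\<^sub>L" by (rule injective_mat_left_factor[OF OL Y]) (use J(2) DY in simp)
  then show ?thesis
    by (intro pinv_projection_eq[OF injective_pinv(1)[OF OL] injective_pinv(1)[OF obsv_upto_carrier obsv] 2 1])
      (use OL X Y in auto)
qed

lemma mat_F_eq:
  assumes l: "0 < l" and obsv: "injective_mat (obsv_upto n)" and \<alpha>: "is_coeffs A B C \<alpha>"
    and qr: "1 < l \<Longrightarrow> vec_space.rank (n * l) (data_hankel A B C k) = n \<and>
      is_QR (data_hankel A B C k) L H"
  shows "mat_F n l \<alpha> L T t = obsv_upto (T - t) * A * (A ^\<^sub>m n * pinv (obsv_upto n))"
proof -
  let ?Y = "pinv (obsv_upto n)"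
  let ?OL = "mat_of_cols (n * l) (take n (cols L))"
  note inj = injective_pinv[OF obsv_upto_carrier obsv]
  note \<alpha>_eq = is_coeffs_eq[OF \<alpha>]
  define G where "G = F_seq n l (kron (char_coeffs A) (1\<^sub>m l)) (obsv_upto n * ?Y)"
  have "(if l = 1 then F_seq n 1 \<alpha> (1\<^sub>m n)
      else F_seq n l (kron \<alpha> (1\<^sub>m l)) (?OL * pinv ?OL)) = G"
  proof (cases "l = 1")
    \<comment> \<open>For a single output the observability matrix is square, so its pseudoinverse
      is an inverse and the projection is the identity, the start value prescribed in this
      case.\<close>
    case True
    then have "obsv_upto n * ?Y = 1\<^sub>m n"
      using mat_mult_left_right_inverse[of ?Y n "obsv_upto n"] inj obsv_upto_carrier[of n] by simp
    moreover have "kron \<alpha> (1\<^sub>m 1) = \<alpha>"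
      by (intro eq_matI) (auto simp: kron_def)
    ultimately show ?thesis using True \<alpha>_eq by (simp add: G_def)
  next
    case False
    then have "1 < l" using l by simp
    with qr have "?OL * pinv ?OL = obsv_upto n * ?Y" using QR_projection[OF _ _ l obsv] by blast
    then show ?thesis using False \<alpha>_eq by (simp add: G_def)
  qed
  moreover have "stack l (n * l) (map (\<lambda>i. G (n + i)) [1..<T - t + 1])
    = obsv_upto (T - t) * A * (A ^\<^sub>m n * ?Y)"
    by (rule stack_F_eq[OF inj(3)]) (simp add: G_def F_seq_eq[OF inj(3)])
  ultimately show ?thesis unfolding mat_F_def Let_def by simp
qed

end

theorem mainTheorem1:
  fixes A B C Q R L H \<alpha> :: "real mat"
    and n m l k T t :: nat
  defines "M \<equiv> big_M A B C T (int t + 1)"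
    and "W \<equiv> big_W A B C Q R T (int t + 1)"
    and "S \<equiv> big_S A B C T (int T - int n + 1)"
    and "E \<equiv> mat_E A B C T t"
    and "F \<equiv> mat_F n l \<alpha> L T t"
  assumes dims: "0 < n" "0 < m" "0 < l"
      "A \<in> carrier_mat n n" "B \<in> carrier_mat n m" "C \<in> carrier_mat l n"
    and ctrb: "controllable A B"
    and obsv: "observable A C"
    and Q: "psd_mat l Q" "invertible_mat Q"
    and R: "pd_mat m R"
    and t: "t < T"
    and coeffs: "is_coeffs A B C \<alpha>"
    and qr: "1 < l \<Longrightarrow> n \<le> m * k \<and> vec_space.rank (n * l) (data_hankel A B C k) = n \<and>
               is_QR (data_hankel A B C k) L H"
  shows "K_LQR A B C Q R T t =
    - (minv (R + transpose_mat M * W * M) * transpose_mat M * W * append_cols (E - F * S) F)"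
proof -
  note [simp] = carrier_matD[OF dims(4)] carrier_matD[OF dims(5)] carrier_matD[OF dims(6)]
  obtain Q' where Q': "Q' \<in> carrier_mat l l" "Q * Q' = 1\<^sub>m l"
  proof -
    from Q(2) obtain Q' where Q': "Q * Q' = 1\<^sub>m (dim_row Q)" "Q' * Q = 1\<^sub>m (dim_row Q')"
      unfolding invertible_mat_def inverts_mat_def by auto
    note Qc = psd_matD(1)[OF Q(1)]
    \<comment> \<open>\<open>invertible_mat\<close> does not fix the size of the inverse; the two
      products with Q determine it.\<close>
    have "dim_col Q' = l" using arg_cong[OF Q'(1), of dim_col] Qc by simp
    moreover have "dim_row Q' = l" using arg_cong[OF Q'(2), of dim_col] Qc by simp
    ultimately show thesis using that Q'(1) Qc by auto
  qed
  obtain R' where R': "R' \<in> carrier_mat m m" "R * R' = 1\<^sub>m m"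
    using pd_inverse_exists[OF R] by blast
  interpret lqr_system A B C n m l Q R Q' R'
    by unfold_locales (use Q R Q' R' in auto)
  define N where "N = T - t"
  define Ob where "Ob = obsv_upto N"
  define Y where "Y = pinv (obsv_upto n)"
  have Ob: "Ob \<in> carrier_mat (N * l) n" by (simp add: Ob_def)
  have On: "obsv_mat A C = obsv_upto n" by (simp add: obsv_mat_def obsv_upto_def)
  have inj: "injective_mat (obsv_upto n)"
    by (rule full_column_rank_injective[OF obsv_upto_carrier]) (use obsv in \<open>simp add: observable_def On\<close>)
  have Y: "Y \<in> carrier_mat n (n * l)" unfolding Y_def by (rule injective_pinv(3)[OF obsv_upto_carrier inj])
  have blocks: "num_blocks T (int t + 1) = N" using t by (simp add: num_blocks_def N_def)
  have M: "M = Ob * B"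
  proof -
    have "M = markov_col N" by (simp add: M_def big_M_def blocks markov_col_def)
    then show ?thesis by (simp only: markov_col_eq Ob_def)
  qed
  have W: "W = weight N" by (simp only: W_def big_W_eq blocks)
  have Wc: "W \<in> carrier_mat (N * l) (N * l)" unfolding W by (rule weight_carrier)
  \<comment> \<open>The integer index T - n + 1 always yields n blocks, also for n > T, where it is
    not positive.\<close>
  have S: "S \<in> carrier_mat (n * l) (n * m)"
    using block_mat_carrier[of n n l m] by (simp add: S_def big_S_def num_blocks_def)
  have E: "E = Ob * A * ctrb_mat A B" by (simp only: E_def mat_E_eq Ob_def N_def)
  have F: "F = Ob * A * (A ^\<^sub>m n * Y)"
    unfolding F_def Ob_def N_def Y_def by (rule mat_F_eq[OF dims(3) inj coeffs]) (use qr in auto)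
  have Fu: "ctrb_mat A B \<in> carrier_mat n (n * m)"
    using block_mat_carrier[of 1 n n m] by (simp add: ctrb_mat_def)
  define P where "P = riccati_P A B C Q R T (t + 1)"
  have P: "P = transpose_mat Ob * W * Ob"
  proof -
    \<comment> \<open>P_(t+1) has T - t - 1 steps to go and so sees T - t outputs, as many as the
      batch matrices have blocks.\<close>
    have "Suc (T - (t + 1)) = N" using t by (simp add: N_def)
    then show ?thesis using riccati_eq[of "T - (t + 1)"] by (simp only: P_def riccati_P_def Ob_def W)
  qed
  have MWM: "transpose_mat M * W * M = transpose_mat B * P * B"
    using Ob Wc by (simp add: P M mult_assoc_dim transpose_mult_dim)
  define G where "G = minv (R + transpose_mat M * W * M)"
  have "psd_mat (N * l) W"
    unfolding W by (rule psd_inverse[OF psd_weight_inv weight_carrier weight_inverse])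
  then have "psd_mat m (transpose_mat M * W * M)"
    by (rule psd_congruence) (use Ob dims(5) in \<open>auto simp: M\<close>)
  then have G: "G \<in> carrier_mat m m"
    unfolding G_def by (auto elim: pd_inverse_exists[OF pd_add_psd[OF R]])
  let ?X = "ctrb_mat A B - A ^\<^sub>m n * Y * S"
  \<comment> \<open>B^T P A equals (Ob B)^T W (Ob A). The state enters only through the predicted
    free outputs Ob A x, so it remains to push Ob A into the map from past data to state.\<close>
  have gain: "state_gain A B C Q R T t = G * transpose_mat M * W * (Ob * A)"
    unfolding state_gain_def Let_def P_def[symmetric] MWM[symmetric] G_def[symmetric]
    using G Ob Wc by (simp add: P M mult_assoc_dim transpose_mult_dim)
  have "K_LQR A B C Q R T t
    = - (G * transpose_mat M * W * (Ob * A) * append_cols ?X (A ^\<^sub>m n * Y))"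
    by (simp add: K_LQR_def Let_def gain On Y_def S_def)
  also have "G * transpose_mat M * W * (Ob * A) * append_cols ?X (A ^\<^sub>m n * Y)
    = G * transpose_mat M * W * (Ob * A * append_cols ?X (A ^\<^sub>m n * Y))"
    using G Ob Wc Y S by (simp add: append_cols_def M mult_assoc_dim)
  also have "Ob * A * append_cols ?X (A ^\<^sub>m n * Y) = append_cols (Ob * A * ?X) F"
    unfolding F by (rule append_cols_mult) (use Ob S Y Fu in auto)
  also have "Ob * A * ?X = E - F * S"
    using Ob S Y Fu by (simp add: E F distrib_dim mult_assoc_dim)
  finally show ?thesis by (simp only: G_def)
qed

end
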